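(* Let $m$ be a positive integer, let $G$ be a graph, let $X\subseteq V(G)$, let $F$ be a factor of $G$, and let $f$ be a positive integer-valued function on $X$. If for every $S\subseteq X$, $$\Omega_m(G\setminus S)\le \sum_{v\in S}\big(f(v)-2m\big)+m+\Omega_m(G[S]),$$ then $G$ has an $m$-tree-connected factor $H$ containing $F$ such that for each $v\in X$, $d_H(v)\le f(v)+\max\{0,d_F(v)-m\}$.
   Context: Graphs are finite, loopless, and may have multiple edges. A factor of $G$ is a spanning subgraph. A graph is $m$-tree-connected if it contains $m$ pairwise edge-disjoint spanning trees (a one-vertex graph is $m$-tree-connected). The $m$-tree-connected components of $G$ are the maximal induced $m$-tree-connected subgraphs of $G$; their vertex sets form a partition $P$ of $V(G)$. For a partition $P$ of $V(G)$, $e_G(P)$ denotes the number of edges of $G$ whose ends lie in different parts of $P$. Define $\Omega_m(G)=m|P|-e_G(P)$, where $P$ is the partition of $V(G)$ into vertex sets of the $m$-tree-connected components of $G$; for the graph with no vertices, $\Omega_m=0$. $G[S]$ is the subgraph induced by $S$, $G\setminus S$ is obtained by deleting the vertices of $S$, and $d_H(v)$ is the degree of $v$ in $H$. *)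

theory Defs
  imports Main
begin

text \<open>
  Loopless multigraphs: every edge has a two-element set of ends, and parallel edges are
  distinct edges with the same ends. The value of \<open>ends\<close> outside \<open>edges\<close> is irrelevant.
  The graph without vertices is allowed.
\<close>

record ('v, 'e) mgraph =
  vertices :: "'v set"
  edges :: "'e set"
  ends :: "'e \<Rightarrow> 'v set"

locale multigraph =
  fixes G :: "('v, 'e) mgraph"
  assumes finite_vertices: "finite (vertices G)"
    and finite_edges: "finite (edges G)"
    and ends_subset: "e \<in> edges G \<Longrightarrow> ends G e \<subseteq> vertices G"
    and card_ends: "e \<in> edges G \<Longrightarrow> card (ends G e) = 2"

definition subgraph :: "('v, 'e) mgraph \<Rightarrow> ('v, 'e) mgraph \<Rightarrow> bool" where
  "subgraph H G \<longleftrightarrow> multigraph H \<and> multigraph G \<and> vertices H \<subseteq> vertices G \<and>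
     edges H \<subseteq> edges G \<and> (\<forall>e \<in> edges H. ends H e = ends G e)"

definition factor :: "('v, 'e) mgraph \<Rightarrow> ('v, 'e) mgraph \<Rightarrow> bool" where
  "factor H G \<longleftrightarrow> subgraph H G \<and> vertices H = vertices G"

definition induced :: "('v, 'e) mgraph \<Rightarrow> 'v set \<Rightarrow> ('v, 'e) mgraph" where
  "induced G S = \<lparr>vertices = vertices G \<inter> S, edges = {e \<in> edges G. ends G e \<subseteq> S}, ends = ends G\<rparr>"

definition delete_vertices :: "('v, 'e) mgraph \<Rightarrow> 'v set \<Rightarrow> ('v, 'e) mgraph" where
  "delete_vertices G S =
     \<lparr>vertices = vertices G - S, edges = {e \<in> edges G. ends G e \<inter> S = {}}, ends = ends G\<rparr>"

definition vertex_degree :: "('v, 'e) mgraph \<Rightarrow> 'v \<Rightarrow> nat" where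
  "vertex_degree G v = card {e \<in> edges G. v \<in> ends G e}"

definition adjacency :: "('v, 'e) mgraph \<Rightarrow> ('v \<times> 'v) set" where
  "adjacency G = {(u, v). \<exists>e \<in> edges G. ends G e = {u, v}}"

definition connected_graph :: "('v, 'e) mgraph \<Rightarrow> bool" where
  "connected_graph G \<longleftrightarrow> (\<forall>u \<in> vertices G. \<forall>v \<in> vertices G. (u, v) \<in> (adjacency G)\<^sup>*)"

text \<open>
  A cycle visits the distinct vertices \<open>vs\<close> in this order and returns to the first one along
  the distinct edges \<open>es\<close>; two parallel edges form a cycle of length two.
\<close>

definition is_cycle :: "('v, 'e) mgraph \<Rightarrow> 'v list \<Rightarrow> 'e list \<Rightarrow> bool" where
  "is_cycle G vs es \<longleftrightarrow> 2 \<le> length vs \<and> length es = length vs \<and> distinct vs \<and> distinct es \<and>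
     set vs \<subseteq> vertices G \<and> set es \<subseteq> edges G \<and>
     (\<forall>i < length vs. ends G (es ! i) = {vs ! i, vs ! (Suc i mod length vs)})"

definition tree_graph :: "('v, 'e) mgraph \<Rightarrow> bool" where
  "tree_graph G \<longleftrightarrow> connected_graph G \<and> (\<nexists>vs es. is_cycle G vs es)"

definition spanning_tree :: "('v, 'e) mgraph \<Rightarrow> ('v, 'e) mgraph \<Rightarrow> bool" where
  "spanning_tree T G \<longleftrightarrow> factor T G \<and> tree_graph T"

text \<open>
  The trees are indexed rather than collected in a set, so that on a one-vertex graph the
  same edgeless tree can be used \<open>m\<close> times. The graph without vertices is (vacuously)
  connected, hence a tree, and hence \<open>m\<close>-tree-connected.
\<close>

definition tree_connected :: "nat \<Rightarrow> ('v, 'e) mgraph \<Rightarrow> bool" where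
  "tree_connected m G \<longleftrightarrow> (\<exists>T :: nat \<Rightarrow> ('v, 'e) mgraph.
     (\<forall>i < m. spanning_tree (T i) G) \<and>
     (\<forall>i < m. \<forall>j < m. i \<noteq> j \<longrightarrow> edges (T i) \<inter> edges (T j) = {}))"

text \<open>
  The partition into the vertex sets of the maximal induced \<open>m\<close>-tree-connected subgraphs.
  Its parts are nonempty; for the graph without vertices it has no part at all.
\<close>

definition tree_components :: "nat \<Rightarrow> ('v, 'e) mgraph \<Rightarrow> 'v set set" where
  "tree_components m G = {C. C \<noteq> {} \<and> C \<subseteq> vertices G \<and> tree_connected m (induced G C) \<and>
     (\<forall>D. C \<subseteq> D \<and> D \<subseteq> vertices G \<and> tree_connected m (induced G D) \<longrightarrow> D = C)}"

definition cross_edges :: "('v, 'e) mgraph \<Rightarrow> 'v set set \<Rightarrow> 'e set" where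
  "cross_edges G P = {e \<in> edges G. \<exists>A \<in> P. \<exists>B \<in> P. A \<noteq> B \<and> ends G e \<inter> A \<noteq> {} \<and> ends G e \<inter> B \<noteq> {}}"

definition Omega :: "nat \<Rightarrow> ('v, 'e) mgraph \<Rightarrow> int" where
  "Omega m G = int m * int (card (tree_components m G))
     - int (card (cross_edges G (tree_components m G)))"

end

(*
  Let r be the rank function of the matroid of edge sets I with at most m(|C| - 1) edges inside
  every nonempty vertex set C. By Nash-Williams, a graph is m-tree-connected iff its rank is
  m(|V| - 1), so Omega_m(G) = m |V| - r(G) and the hypothesis becomes
      m(|V| - 1) <= sum_S f + r(G - S) - r(G[S]).
  Put g(v) = f(v) - min(m, d_F(v)). Among the edge sets T outside F for which F + T spans and
  |T| = r(G) - r(F), take one of minimum total excess over g on X. If some degree in T exceeds g,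
  a Win-type exchange argument yields S \<subseteq> X containing all such vertices, with d_T >= g on S,
  such that F together with the edges of T that avoid S spans every edge of G - S. Counting the
  edges of T at S contradicts the hypothesis for S, because
      r(F + E(G - S)) - r(G - S) + r(F[S]) >= sum_S min(m, d_F(v)).
*)

theory Submission
  imports Defs
begin

section \<open>Rank and span in a finite matroid\<close>

text \<open>The prescribed edges of F may be dependent, so the search runs over the bases of the
  matroid contracted by F; F itself is never touched by an exchange. The obstacle is that a vertex
  of too large degree cannot in general be relieved by one swap: the incoming edge raises the
  degrees of its own two ends. Room at these ends must be made first, by changes that must interfere
  neither with each other nor with the swap. Hence changes are confined to tree-connected components
  left after deleting a set S, and S grows by layers of those vertices at which no such change makes
  room. The term min(m, d_F(v)) arises because up to m edges at v are independent over every edge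
  set that avoids v. It also yields the final bound, as d_F(v) + f(v) - min(m, d_F(v)) = f(v) +
  max(0, d_F(v) - m). In the final count, the sum of d_T over S counts the edges of T meeting S,
  which number r(G) - r(F + E(G - S)), and once more those inside S, at most r(G[S]) - r(F[S]) in
  number.\<close>

definition set_rank :: "('e set \<Rightarrow> bool) \<Rightarrow> 'e set \<Rightarrow> nat" where
  "set_rank indep A = Max (card ` {I. I \<subseteq> A \<and> indep I})"

locale finite_matroid =
  fixes E :: "'e set" and indep :: "'e set \<Rightarrow> bool"
  assumes finite_carrier: "finite E"
    and indep_empty: "indep {}"
    and indep_subset: "indep I \<Longrightarrow> I \<subseteq> E \<Longrightarrow> J \<subseteq> I \<Longrightarrow> indep J"
    and augment: "I \<subseteq> E \<Longrightarrow> J \<subseteq> E \<Longrightarrow> indep I \<Longrightarrow> indep J \<Longrightarrow> card I < card J \<Longrightarrow>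
      \<exists>e \<in> J - I. indep (insert e I)"
begin

abbreviation rank :: "'e set \<Rightarrow> nat" where
  "rank \<equiv> set_rank indep"

lemma finite_sub: "A \<subseteq> E \<Longrightarrow> finite A"
  using finite_carrier finite_subset by blast

lemma card_le_rank:
  assumes "A \<subseteq> E" "I \<subseteq> A" "indep I"
  shows "card I \<le> rank A"
proof -
  have "finite (card ` {I. I \<subseteq> A \<and> indep I})"
    using finite_sub[OF assms(1)] by simp
  then show ?thesis
    unfolding set_rank_def using assms by (intro Max_ge) auto
qed

lemma rank_attained:
  assumes "A \<subseteq> E"
  obtains I where "I \<subseteq> A" "indep I" "card I = rank A"
proof -
  have "finite (card ` {I. I \<subseteq> A \<and> indep I})"
    using finite_sub[OF assms(1)] by simp
  moreover have "card ` {I. I \<subseteq> A \<and> indep I} \<noteq> {}"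
    using indep_empty by auto
  ultimately have "rank A \<in> card ` {I. I \<subseteq> A \<and> indep I}"
    unfolding set_rank_def by (rule Max_in)
  then show ?thesis
    using that by auto
qed

lemma rank_mono: "A \<subseteq> B \<Longrightarrow> B \<subseteq> E \<Longrightarrow> rank A \<le> rank B"
  by (metis card_le_rank order_trans rank_attained)

lemma rank_indep: "I \<subseteq> E \<Longrightarrow> indep I \<Longrightarrow> rank I = card I"
  by (metis card_le_rank card_mono finite_sub order_antisym order_refl rank_attained)

lemma extend_to_basis:
  assumes "I \<subseteq> A" "A \<subseteq> E" "indep I"
  obtains B where "I \<subseteq> B" "B \<subseteq> A" "indep B" "card B = rank A"
proof -
  have "finite {B. I \<subseteq> B \<and> B \<subseteq> A \<and> indep B}"
    using finite_sub[OF assms(2)] by simp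
  moreover have "{B. I \<subseteq> B \<and> B \<subseteq> A \<and> indep B} \<noteq> {}"
    using assms by auto
  ultimately obtain B where B: "I \<subseteq> B" "B \<subseteq> A" "indep B"
    and max: "\<And>B'. I \<subseteq> B' \<Longrightarrow> B' \<subseteq> A \<Longrightarrow> indep B' \<Longrightarrow> B \<subseteq> B' \<Longrightarrow> B = B'"
    by (metis (mono_tags, lifting) finite_has_maximal mem_Collect_eq)
  obtain J where J: "J \<subseteq> A" "indep J" "card J = rank A"
    using rank_attained[OF assms(2)] .
  have "card B = rank A"
  proof (rule ccontr)
    assume "card B \<noteq> rank A"
    then have "card B < card J"
      using card_le_rank[OF assms(2) B(2,3)] J(3) by simp
    then obtain e where "e \<in> J - B" "indep (insert e B)"
      using augment[of B J] B J assms(2) by blast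
    then show False
      using max[of "insert e B"] B J by auto
  qed
  then show ?thesis
    using that B by blast
qed

lemma card_eq_rank:
  assumes "A \<subseteq> E" "B \<subseteq> A" "indep B" and "\<And>e. e \<in> A - B \<Longrightarrow> \<not> indep (insert e B)"
  shows "card B = rank A"
proof -
  obtain C where C: "B \<subseteq> C" "C \<subseteq> A" "indep C" "card C = rank A"
    using extend_to_basis[OF assms(2,1,3)] .
  have "C \<subseteq> B"
  proof
    fix e assume "e \<in> C"
    then show "e \<in> B"
      using assms(1,4) C indep_subset[OF C(3), of "insert e B"] by blast
  qed
  then show ?thesis
    using C by auto
qed

lemma rank_submodular:
  assumes "A \<subseteq> E" "B \<subseteq> E"
  shows "rank (A \<union> B) + rank (A \<inter> B) \<le> rank A + rank B"
proof -
  obtain I where I: "I \<subseteq> A \<inter> B" "indep I" "card I = rank (A \<inter> B)"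
    using rank_attained[of "A \<inter> B"] assms by blast
  then have "I \<subseteq> A \<union> B" "A \<union> B \<subseteq> E"
    using assms by auto
  then obtain J where J: "I \<subseteq> J" "J \<subseteq> A \<union> B" "indep J" "card J = rank (A \<union> B)"
    using extend_to_basis[OF _ _ I(2)] by metis
  have fin: "finite J"
    using J(2) assms by (meson finite_sub le_sup_iff order_trans)
  have "card (J \<inter> A) \<le> rank A" "card (J \<inter> B) \<le> rank B"
    using card_le_rank assms J(2) by (auto intro!: card_le_rank indep_subset[OF J(3)])
  moreover have "card J = card ((J \<inter> A) \<union> (J \<inter> B))"
    using J(2) by (intro arg_cong[of _ _ card]) blast
  moreover have "card ((J \<inter> A) \<union> (J \<inter> B)) + card ((J \<inter> A) \<inter> (J \<inter> B)) = card (J \<inter> A) + card (J \<inter> B)"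
    using fin by (simp add: card_Un_Int[symmetric])
  moreover have "card I \<le> card ((J \<inter> A) \<inter> (J \<inter> B))"
    using I J fin by (intro card_mono) auto
  ultimately show ?thesis
    using I(3) J(4) by linarith
qed

text \<open>Diminishing returns: submodularity for \<open>B\<close> and \<open>A \<union> C\<close>.
  The additive form avoids truncated subtraction.\<close>

lemma rank_gain_antimono:
  assumes "A \<subseteq> B" "B \<subseteq> E" "C \<subseteq> E"
  shows "rank (B \<union> C) + rank A \<le> rank (A \<union> C) + rank B"
proof -
  have "rank (B \<union> (A \<union> C)) + rank (B \<inter> (A \<union> C)) \<le> rank B + rank (A \<union> C)"
    using assms by (intro rank_submodular) auto
  moreover have "rank A \<le> rank (B \<inter> (A \<union> C))"
    using assms by (intro rank_mono) auto
  moreover have "B \<union> (A \<union> C) = B \<union> C"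
    using assms by blast
  ultimately show ?thesis
    by simp
qed

lemma rank_le_card: "A \<subseteq> E \<Longrightarrow> rank A \<le> card A"
  by (metis card_mono finite_sub rank_attained)

lemma rank_empty: "rank {} = 0"
  using rank_le_card[of "{}"] by simp

lemma rank_Un_le: "A \<subseteq> E \<Longrightarrow> C \<subseteq> E \<Longrightarrow> rank (A \<union> C) \<le> rank A + card C"
  using rank_gain_antimono[of "{}" A C] rank_le_card[of C] rank_empty by simp

section \<open>Closure operator and exchange\<close>

definition span :: "'e set \<Rightarrow> 'e set" where
  "span A = {e \<in> E. rank (insert e A) = rank A}"

lemma span_subset: "span A \<subseteq> E"
  by (auto simp: span_def)

lemma span_superset: "A \<subseteq> E \<Longrightarrow> A \<subseteq> span A"
  by (auto simp: span_def insert_absorb)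

lemma span_mono:
  assumes "A \<subseteq> B" "B \<subseteq> E"
  shows "span A \<subseteq> span B"
proof
  fix e assume e: "e \<in> span A"
  then have "rank (B \<union> {e}) + rank A \<le> rank (A \<union> {e}) + rank B"
    using assms by (intro rank_gain_antimono) (auto simp: span_def)
  moreover have "rank B \<le> rank (insert e B)"
    using e assms by (intro rank_mono) (auto simp: span_def)
  ultimately show "e \<in> span B"
    using e by (simp add: span_def)
qed

lemma rank_Un_span:
  assumes "A \<subseteq> E" "B \<subseteq> span A"
  shows "rank (A \<union> B) = rank A"
proof -
  have "finite B"
    using assms(2) span_subset finite_sub by (meson order_trans)
  then show ?thesis
    using assms(2)
  proof (induction B)
    case (insert e B)
    have "A \<union> B \<subseteq> E"
      using assms(1) insert.prems span_subset by blast
    then have "e \<in> span (A \<union> B)"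
      using span_mono[of A "A \<union> B"] insert.prems by blast
    then show ?case
      using insert by (simp add: span_def)
  qed simp
qed

lemma span_rank_eq:
  assumes "A \<subseteq> B" "B \<subseteq> E" "rank A = rank B"
  shows "B \<subseteq> span A"
proof
  fix e assume "e \<in> B"
  then have "rank A \<le> rank (insert e A)" "rank (insert e A) \<le> rank B"
    using assms by (blast intro: rank_mono)+
  then show "e \<in> span A"
    using assms \<open>e \<in> B\<close> by (auto simp: span_def)
qed

lemma span_minimal:
  assumes "B \<subseteq> span A" "A \<subseteq> E"
  shows "span B \<subseteq> span A"
proof -
  have "A \<union> B \<subseteq> E"
    using assms span_subset by blast
  then have "span B \<subseteq> span (A \<union> B)"
    by (intro span_mono) auto
  moreover have "span (A \<union> B) \<subseteq> span A"
  proof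
    fix e assume e: "e \<in> span (A \<union> B)"
    then have "e \<in> E" and "rank (insert e (A \<union> B)) = rank A"
      using rank_Un_span[OF assms(2,1)] by (simp_all add: span_def)
    then show "e \<in> span A"
      using span_rank_eq[of A "insert e (A \<union> B)"] \<open>A \<union> B \<subseteq> E\<close> by auto
  qed
  ultimately show ?thesis
    by blast
qed

lemma span_exchange:
  assumes "A \<subseteq> E" "f \<in> E" "e \<in> span (insert f A)" "e \<notin> span A"
  shows "f \<in> span (insert e A)"
proof -
  have e: "e \<in> E"
    using assms(3) by (simp add: span_def)
  have "rank A < rank (insert e A)"
    using assms(1,4) e rank_mono[of A "insert e A"] by (fastforce simp: span_def)
  moreover have "rank (insert f A) \<le> rank A + 1"
    using rank_Un_le[of A "{f}"] assms by simp
  moreover have "rank (insert e (insert f A)) = rank (insert f A)"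
    using assms(3) by (simp add: span_def)
  moreover have "rank (insert e A) \<le> rank (insert f (insert e A))"
    using assms e by (intro rank_mono) auto
  ultimately show ?thesis
    using assms(2) by (simp add: span_def insert_commute)
qed

text \<open>Add the elements of \<open>Z\<close> to \<open>A\<close> one at a time: the first one
  that brings \<open>e\<close> into the span can be exchanged for \<open>e\<close>, and monotonicity
  restores the elements added later.\<close>

lemma span_exchange_set:
  assumes "A \<subseteq> E" "Z \<subseteq> E" "e \<in> span (A \<union> Z)" "e \<notin> span A"
  obtains f where "f \<in> Z - A" "f \<in> span (insert e (A \<union> (Z - {f})))"
proof -
  have "finite Z"
    using assms(2) finite_sub by blast
  then have "Z \<subseteq> E \<longrightarrow> e \<in> span (A \<union> Z) \<longrightarrow> (\<exists>f \<in> Z - A. f \<in> span (insert e (A \<union> (Z - {f}))))"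
  proof (induction Z)
    case empty
    then show ?case
      using assms(4) by simp
  next
    case (insert h Z)
    show ?case
    proof (intro impI)
      assume Z: "insert h Z \<subseteq> E" and e: "e \<in> span (A \<union> insert h Z)"
      have eE: "e \<in> E"
        using e by (simp add: span_def)
      show "\<exists>f \<in> insert h Z - A. f \<in> span (insert e (A \<union> (insert h Z - {f})))"
      proof (cases "e \<in> span (A \<union> Z)")
        case True
        then obtain f where f: "f \<in> Z - A" "f \<in> span (insert e (A \<union> (Z - {f})))"
          using insert.IH Z by blast
        moreover have "span (insert e (A \<union> (Z - {f}))) \<subseteq> span (insert e (A \<union> (insert h Z - {f})))"
          using Z assms(1) eE by (intro span_mono) auto
        ultimately show ?thesis
          by blast
      next
        case False
        then have "h \<notin> A"
          using e insert.hyps by (auto simp: insert_absorb)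
        moreover have "h \<in> span (insert e (A \<union> Z))"
          using span_exchange[of "A \<union> Z" h e] False e Z assms(1) by simp
        ultimately show ?thesis
          using insert.hyps by (intro bexI[of _ h]) simp_all
      qed
    qed
  qed
  then show ?thesis
    using assms that by blast
qed

end

section \<open>Forests and connectivity\<close>

definition within :: "('e \<Rightarrow> 'v set) \<Rightarrow> 'e set \<Rightarrow> 'v set \<Rightarrow> 'e set" where
  "within en A C = {e \<in> A. en e \<subseteq> C}"

definition reach :: "('e \<Rightarrow> 'v set) \<Rightarrow> 'e set \<Rightarrow> ('v \<times> 'v) set" where
  "reach en A = {(u, v). \<exists>e \<in> A. en e = {u, v}}\<^sup>*"

text \<open>Acyclicity in the form that every edge is a bridge, which needs no lists of vertices and
  edges; \<open>forest_no_cycle\<close> leads back to \<open>is_cycle\<close>.\<close>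

definition forest :: "('e \<Rightarrow> 'v set) \<Rightarrow> 'e set \<Rightarrow> bool" where
  "forest en A \<longleftrightarrow> (\<forall>e \<in> A. \<forall>u v. en e = {u, v} \<longrightarrow> (u, v) \<notin> reach en (A - {e}))"

lemma within_subset: "within en A C \<subseteq> A"
  by (auto simp: within_def)

lemma within_mono: "A \<subseteq> B \<Longrightarrow> C \<subseteq> D \<Longrightarrow> within en A C \<subseteq> within en B D"
  by (auto simp: within_def)

lemma reach_refl [simp]: "(u, u) \<in> reach en A"
  by (simp add: reach_def)

lemma reach_trans: "(u, v) \<in> reach en A \<Longrightarrow> (v, w) \<in> reach en A \<Longrightarrow> (u, w) \<in> reach en A"
  unfolding reach_def by (rule rtrancl_trans)

lemma reach_sym: "(u, v) \<in> reach en A \<Longrightarrow> (v, u) \<in> reach en A"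
proof -
  have "sym {(u, v). \<exists>e \<in> A. en e = {u, v}}"
    by (auto simp: sym_def insert_commute)
  then show "(u, v) \<in> reach en A \<Longrightarrow> (v, u) \<in> reach en A"
    unfolding reach_def by (meson sym_rtrancl symD)
qed

lemma reach_class_eq_iff: "reach en A `` {a} = reach en A `` {b} \<longleftrightarrow> (a, b) \<in> reach en A"
proof -
  have "equiv UNIV (reach en A)"
    by (intro equivI refl_onI symI transI) (auto intro: reach_sym reach_trans)
  then show ?thesis
    by (simp add: eq_equiv_class_iff)
qed

lemma reach_edge: "e \<in> A \<Longrightarrow> en e = {u, v} \<Longrightarrow> (u, v) \<in> reach en A"
  unfolding reach_def by (rule r_into_rtrancl) auto

lemma reach_subsetI:
  assumes "\<And>e u v. e \<in> A \<Longrightarrow> en e = {u, v} \<Longrightarrow> (u, v) \<in> reach en B"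
  shows "reach en A \<subseteq> reach en B"
  using assms unfolding reach_def by (intro rtrancl_subset_rtrancl) auto

lemma reach_mono: "A \<subseteq> B \<Longrightarrow> reach en A \<subseteq> reach en B"
  by (rule reach_subsetI) (auto intro: reach_edge)

text \<open>A walk can be shortened until it uses \<open>e\<close> at most once; the last two cases
  are the two directions of passing through \<open>e\<close>.\<close>

lemma reach_insert:
  assumes "en e = {u, v}"
  shows "(a, b) \<in> reach en (insert e A) \<longleftrightarrow> (a, b) \<in> reach en A \<or>
    (a, u) \<in> reach en A \<and> (v, b) \<in> reach en A \<or> (a, v) \<in> reach en A \<and> (u, b) \<in> reach en A"
    (is "?L \<longleftrightarrow> ?R b")
proof
  assume ?L
  then show "?R b"
    unfolding reach_def[of en "insert e A"]
  proof (induction rule: rtrancl_induct)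
    case (step b c)
    from step.hyps(2) consider "\<exists>h\<in>A. en h = {b, c}" | "{b, c} = {u, v}"
      using assms by auto
    then show ?case
    proof cases
      case 1
      then have "(b, c) \<in> reach en A"
        by (elim bexE) (rule reach_edge)
      then show ?thesis
        using step.IH reach_trans by metis
    next
      case 2
      then have "b = u \<and> c = v \<or> b = v \<and> c = u"
        by (metis doubleton_eq_iff)
      then show ?thesis
        using step.IH reach_refl reach_trans by metis
    qed
  qed simp
next
  assume "?R b"
  moreover have "(u, v) \<in> reach en (insert e A)" "(v, u) \<in> reach en (insert e A)"
    using reach_edge[of e "insert e A" en] assms by (auto simp: insert_commute)
  moreover have "reach en A \<subseteq> reach en (insert e A)"
    by (rule reach_mono) auto
  ultimately show ?L
    by (meson reach_trans subsetD)
qed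

lemma forest_subset: "forest en A \<Longrightarrow> B \<subseteq> A \<Longrightarrow> forest en B"
  unfolding forest_def by (meson Diff_mono reach_mono subset_eq)

lemma forest_insert:
  assumes "forest en A" "en e = {u, v}" "(u, v) \<notin> reach en A"
  shows "forest en (insert e A)"
  unfolding forest_def
proof (intro ballI allI impI)
  fix h a b assume h: "h \<in> insert e A" and ab: "en h = {a, b}"
  show "(a, b) \<notin> reach en (insert e A - {h})"
  proof (cases "h = e")
    case True
    have "(a, b) \<notin> reach en A"
      using assms(2,3) ab True by (metis doubleton_eq_iff reach_sym)
    then show ?thesis
      using True reach_mono[of "insert e A - {h}" A en] by auto
  next
    case False
    then have hA: "h \<in> A" and eq: "insert e A - {h} = insert e (A - {h})"
      using h by auto
    have no: "(a, b) \<notin> reach en (A - {h})"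
      using assms(1) hA ab by (auto simp: forest_def)
    have sub: "reach en (A - {h}) \<subseteq> reach en A"
      by (rule reach_mono) auto
    have "(a, b) \<in> reach en A" "(b, a) \<in> reach en A"
      using hA ab reach_edge reach_sym by metis+
    then show ?thesis
      unfolding eq reach_insert[of en e u v, OF assms(2)]
      using no sub assms(3) by (meson reach_sym reach_trans subsetD)
  qed
qed

text \<open>Each new edge is a bridge and so merges exactly two classes, those of its ends. The
  number of edges plus the number of classes therefore stays at its value for the edgeless set,
  where all classes are singletons.\<close>

lemma forest_card_classes:
  assumes "finite C" "finite A" "forest en A" "\<And>e. e \<in> A \<Longrightarrow> en e \<subseteq> C \<and> card (en e) = 2"
  shows "card A + card ((\<lambda>u. reach en A `` {u}) ` C) = card C"
  using assms(2-)
proof (induction A)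
  case empty
  have "reach en {} = Id"
    by (simp add: reach_def)
  then have "(\<lambda>u. reach en {} `` {u}) ` C = (\<lambda>u. {u}) ` C"
    by auto
  then show ?case
    by (simp add: card_image)
next
  case (insert e A)
  obtain u v where uv: "en e = {u, v}" "u \<noteq> v"
    using insert.prems(2)[of e] by (meson card_2_iff insertI1)
  let ?cl = "\<lambda>u. reach en A `` {u}" and ?cl' = "\<lambda>u. reach en (insert e A) `` {u}"
  have IH: "card A + card (?cl ` C) = card C"
    using insert forest_subset[of en "insert e A" A] by auto
  have no: "(u, v) \<notin> reach en A"
    using insert.prems(1) insert.hyps(2) uv(1) unfolding forest_def by (metis Diff_insert_absorb insertI1)
  have C: "u \<in> C" "v \<in> C"
    using insert.prems(2)[of e] uv by auto
  note cl_eq = reach_class_eq_iff[of en A]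
  have cl'_eq: "?cl' a = (if (a, u) \<in> reach en A \<or> (a, v) \<in> reach en A then ?cl u \<union> ?cl v else ?cl a)" for a
  proof (cases "(a, u) \<in> reach en A \<or> (a, v) \<in> reach en A")
    case True
    then have "?cl a = ?cl u \<or> ?cl a = ?cl v"
      using cl_eq by blast
    have "b \<in> ?cl' a \<longleftrightarrow> b \<in> ?cl u \<union> ?cl v" for b
    proof -
      have "(a, b) \<in> reach en A \<Longrightarrow> b \<in> ?cl u \<union> ?cl v"
        using \<open>?cl a = ?cl u \<or> ?cl a = ?cl v\<close> by blast
      then show ?thesis
        using True reach_insert[of en e u v a b A, OF uv(1)] reach_trans[of a u en A b] reach_trans[of a v en A b]
        by (simp only: Un_iff Image_singleton_iff) metis
    qed
    then show ?thesis
      using True by (simp only: set_eq_iff if_True simp_thms)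
  next
    case False
    then show ?thesis
      using reach_insert[of en e u v a _ A, OF uv(1)] by auto
  qed
  have "?cl' ` C = insert (?cl u \<union> ?cl v) (?cl ` C - {?cl u, ?cl v})"
  proof (intro equalityI subsetI)
    fix Y assume "Y \<in> ?cl' ` C"
    then obtain a where "a \<in> C" "Y = ?cl' a"
      by blast
    then show "Y \<in> insert (?cl u \<union> ?cl v) (?cl ` C - {?cl u, ?cl v})"
      using cl'_eq[of a] cl_eq[of a u] cl_eq[of a v] by (auto split: if_splits)
  next
    fix Y assume "Y \<in> insert (?cl u \<union> ?cl v) (?cl ` C - {?cl u, ?cl v})"
    then consider "Y = ?cl u \<union> ?cl v" | a where "a \<in> C" "Y = ?cl a" "?cl a \<noteq> ?cl u" "?cl a \<noteq> ?cl v"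
      by blast
    then show "Y \<in> ?cl' ` C"
    proof cases
      case 1
      then have "Y = ?cl' u"
        using cl'_eq[of u] by simp
      then show ?thesis
        using C by blast
    next
      case 2
      then have "Y = ?cl' a"
        using cl'_eq[of a] cl_eq[of a u] cl_eq[of a v] by auto
      then show ?thesis
        using 2 by blast
    qed
  qed
  moreover have "?cl u \<union> ?cl v \<notin> ?cl ` C - {?cl u, ?cl v}"
  proof
    assume "?cl u \<union> ?cl v \<in> ?cl ` C - {?cl u, ?cl v}"
    then obtain a where a: "?cl u \<union> ?cl v = ?cl a" "?cl a \<noteq> ?cl u"
      by auto
    then have "(a, u) \<in> reach en A"
      using reach_refl[of u en A] by blast
    then show False
      using a(2) cl_eq by blast
  qed
  moreover have "card (?cl ` C - {?cl u, ?cl v}) = card (?cl ` C) - 2"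
    using C no cl_eq[of u v] assms(1) by (subst card_Diff_subset) auto
  moreover have "2 \<le> card (?cl ` C)"
  proof -
    have "card {?cl u, ?cl v} \<le> card (?cl ` C)"
      using C assms(1) by (intro card_mono) auto
    then show ?thesis
      using no cl_eq[of u v] by simp
  qed
  ultimately have "card (?cl' ` C) = card (?cl ` C) - 1"
    using assms(1) by simp
  then show ?case
    using IH insert.hyps \<open>2 \<le> card (?cl ` C)\<close> by simp
qed

lemma forest_card_le:
  assumes "finite C" "C \<noteq> {}" "finite A" "forest en A" "\<And>e. e \<in> A \<Longrightarrow> en e \<subseteq> C \<and> card (en e) = 2"
  shows "card A \<le> card C - 1"
proof -
  have "card ((\<lambda>u. reach en A `` {u}) ` C) > 0"
    using assms(1,2) by (simp add: card_gt_0_iff)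
  then show ?thesis
    using forest_card_classes[of C A en] assms by simp
qed

lemma forest_connected_iff_card:
  assumes "finite C" "C \<noteq> {}" "finite A" "forest en A" "\<And>e. e \<in> A \<Longrightarrow> en e \<subseteq> C \<and> card (en e) = 2"
  shows "C \<times> C \<subseteq> reach en A \<longleftrightarrow> card A = card C - 1"
proof -
  let ?cl = "\<lambda>u. reach en A `` {u}"
  have eq: "card A + card (?cl ` C) = card C"
    using forest_card_classes[of C A en] assms by simp
  obtain c where c: "c \<in> C"
    using assms(2) by blast
  have "C \<times> C \<subseteq> reach en A \<longleftrightarrow> ?cl ` C = {?cl c}"
  proof
    assume *: "C \<times> C \<subseteq> reach en A"
    have "?cl a = ?cl c" if "a \<in> C" for a
      using * that c reach_class_eq_iff[of en A a c] by blast
    then have "?cl ` C = (\<lambda>_. ?cl c) ` C"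
      by (rule image_cong[OF refl])
    then show "?cl ` C = {?cl c}"
      using c by auto
  next
    assume *: "?cl ` C = {?cl c}"
    show "C \<times> C \<subseteq> reach en A"
    proof clarify
      fix a b assume "a \<in> C" "b \<in> C"
      then have "?cl a \<in> {?cl c}" "?cl b \<in> {?cl c}"
        using imageI[of a C ?cl] imageI[of b C ?cl] unfolding * by simp_all
      then show "(a, b) \<in> reach en A"
        by (simp flip: reach_class_eq_iff)
    qed
  qed
  moreover have "?cl ` C = {?cl c} \<longleftrightarrow> card (?cl ` C) = 1"
  proof
    assume "card (?cl ` C) = 1"
    then obtain Y where "?cl ` C = {Y}"
      by (rule card_1_singletonE)
    then show "?cl ` C = {?cl c}"
      using imageI[OF c, of ?cl] by simp
  qed simp
  moreover have "card (?cl ` C) > 0"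
    using assms(1,2) by (simp add: card_gt_0_iff)
  ultimately show ?thesis
    using eq by auto
qed

text \<open>In an inclusion-minimal connecting subset every edge is a bridge, since otherwise it
  could be dropped.\<close>

lemma spanning_forest_exists:
  assumes "finite A" "C \<times> C \<subseteq> reach en A"
  obtains B where "B \<subseteq> A" "forest en B" "C \<times> C \<subseteq> reach en B"
proof -
  have "finite {B. B \<subseteq> A \<and> C \<times> C \<subseteq> reach en B}"
    using assms(1) by simp
  moreover have "{B. B \<subseteq> A \<and> C \<times> C \<subseteq> reach en B} \<noteq> {}"
    using assms(2) by auto
  ultimately obtain B where B: "B \<subseteq> A" "C \<times> C \<subseteq> reach en B"
    and min: "\<And>B'. B' \<subseteq> A \<Longrightarrow> C \<times> C \<subseteq> reach en B' \<Longrightarrow> B' \<subseteq> B \<Longrightarrow> B = B'"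
    by (metis (mono_tags, lifting) finite_has_minimal mem_Collect_eq)
  have "forest en B"
    unfolding forest_def
  proof (intro ballI allI impI notI)
    fix e u v assume e: "e \<in> B" "en e = {u, v}" and r: "(u, v) \<in> reach en (B - {e})"
    have "reach en B \<subseteq> reach en (B - {e})"
    proof (rule reach_subsetI)
      fix h a b assume h: "h \<in> B" "en h = {a, b}"
      show "(a, b) \<in> reach en (B - {e})"
      proof (cases "h = e")
        case True
        then show ?thesis
          using h e r by (metis doubleton_eq_iff reach_sym)
      next
        case False
        then show ?thesis
          using h by (auto intro: reach_edge)
      qed
    qed
    then show False
      using min[of "B - {e}"] B e by auto
  qed
  then show ?thesis
    using that B by blast
qed

text \<open>An inclusion-minimal subset \<open>W\<close> joining \<open>u\<close> to
  \<open>v\<close> plays the role of the path in the forest. Each of its edges lies on the cycle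
  closed by \<open>e\<close>, so it can be traded for \<open>e\<close>.\<close>

lemma forest_path_edges:
  assumes "finite A" "forest en A" "en e = {u, v}" "(u, v) \<in> reach en A"
  shows "(u, v) \<in> reach en {g \<in> A. forest en (insert e (A - {g}))}"
proof -
  have "finite {W. W \<subseteq> A \<and> (u, v) \<in> reach en W}"
    using assms(1) by simp
  moreover have "{W. W \<subseteq> A \<and> (u, v) \<in> reach en W} \<noteq> {}"
    using assms(4) by auto
  ultimately obtain W where W: "W \<subseteq> A" "(u, v) \<in> reach en W"
    and min: "\<And>W'. W' \<subseteq> A \<Longrightarrow> (u, v) \<in> reach en W' \<Longrightarrow> W' \<subseteq> W \<Longrightarrow> W = W'"
    by (metis (mono_tags, lifting) finite_has_minimal mem_Collect_eq)
  have "W \<subseteq> {g \<in> A. forest en (insert e (A - {g}))}"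
  proof
    fix g assume g: "g \<in> W"
    have gA: "g \<in> A"
      using g W by blast
    have no: "(u, v) \<notin> reach en (W - {g})"
      using min[of "W - {g}"] W g by auto
    have "(u, v) \<notin> reach en (A - {g})"
    proof
      assume r: "(u, v) \<in> reach en (A - {g})"
      \<comment> \<open>Edges are not assumed to have two ends here. An edge whose end set is not of
        the form {a, b} contributes nothing to \<open>reach\<close>, so minimality excludes it from
        \<open>W\<close>.\<close>
      have "\<exists>a b. en g = {a, b}"
      proof (rule ccontr)
        assume "\<nexists>a b. en g = {a, b}"
        then have "reach en W \<subseteq> reach en (W - {g})"
          by (intro reach_subsetI) (metis Diff_iff empty_iff insert_iff reach_edge)
        then show False
          using W no by blast
      qed
      then obtain a b where ab: "en g = {a, b}"
        by blast
      have "(u, v) \<in> reach en (insert g (W - {g}))"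
        using W g by (simp add: insert_absorb)
      then have "(u, a) \<in> reach en (W - {g}) \<and> (b, v) \<in> reach en (W - {g}) \<or>
          (u, b) \<in> reach en (W - {g}) \<and> (a, v) \<in> reach en (W - {g})"
        using no reach_insert[of en g a b, OF ab] by blast
      moreover have "reach en (W - {g}) \<subseteq> reach en (A - {g})"
        using W by (intro reach_mono) auto
      ultimately have "(a, b) \<in> reach en (A - {g})"
        using r by (meson reach_sym reach_trans subsetD)
      then show False
        using assms(2) gA ab by (auto simp: forest_def)
    qed
    then have "forest en (insert e (A - {g}))"
      using forest_insert[of en "A - {g}" e u v] forest_subset[OF assms(2)] assms(3) by auto
    then show "g \<in> {g \<in> A. forest en (insert e (A - {g}))}"
      using gA by simp
  qed
  then show ?thesis
    using W(2) reach_mono by blast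
qed

section \<open>Decomposing sparse edge sets into forests\<close>

text \<open>No graph occurs here and \<open>C\<close> ranges over all finite vertex sets, so an edge
  set has the same rank in every graph with the same end map. This lets rank formulas from different
  interpretations of \<open>graph_sparsity\<close> (for \<open>G\<close>, its induced subgraphs, a
  factor) be compared directly.\<close>

definition sparse :: "nat \<Rightarrow> ('e \<Rightarrow> 'v set) \<Rightarrow> 'e set \<Rightarrow> bool" where
  "sparse m en A \<longleftrightarrow> (\<forall>C. finite C \<and> C \<noteq> {} \<longrightarrow> card (within en A C) \<le> m * (card C - 1))"

locale forest_packing =
  fixes m :: nat and en :: "'e \<Rightarrow> 'v set" and J :: "'e set"
  assumes finite_J: "finite J"
    and card_en: "e \<in> J \<Longrightarrow> card (en e) = 2"
begin

definition packing :: "(nat \<Rightarrow> 'e set) \<Rightarrow> bool" where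
  "packing c \<longleftrightarrow> (\<forall>i < m. c i \<subseteq> J \<and> forest en (c i)) \<and> (\<forall>i < m. \<forall>j < m. i \<noteq> j \<longrightarrow> c i \<inter> c j = {})"

abbreviation cover :: "(nat \<Rightarrow> 'e set) \<Rightarrow> 'e set" where
  "cover c \<equiv> (\<Union>i < m. c i)"

definition maximum_packing :: "(nat \<Rightarrow> 'e set) \<Rightarrow> bool" where
  "maximum_packing c \<longleftrightarrow> packing c \<and> (\<forall>d. packing d \<longrightarrow> card (cover d) \<le> card (cover c))"

text \<open>The exchange sequences of matroid union: an uncovered edge enters one forest and pushes
  out an edge, which becomes uncovered in turn. The size of the cover is preserved, so a maximum
  packing leads only to maximum packings.\<close>

inductive_set swappable :: "(nat \<Rightarrow> 'e set) \<Rightarrow> (nat \<Rightarrow> 'e set) set" for c where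
  start: "c \<in> swappable c"
| swap: "d \<in> swappable c \<Longrightarrow> i < m \<Longrightarrow> e \<in> J - cover d \<Longrightarrow> g \<in> d i \<Longrightarrow>
    forest en (insert e (d i - {g})) \<Longrightarrow> d(i := insert e (d i - {g})) \<in> swappable c"

definition uncovered :: "(nat \<Rightarrow> 'e set) \<Rightarrow> 'e set" where
  "uncovered c = (\<Union>d \<in> swappable c. J - cover d)"

lemma cover_finite: "packing c \<Longrightarrow> finite (cover c)"
  by (auto simp: packing_def intro: finite_subset[OF _ finite_J])

lemma cover_upd: "i < m \<Longrightarrow> cover (d(i := X)) = X \<union> (\<Union>j \<in> {..<m} - {i}. d j)"
  by (auto split: if_splits)

lemma packing_upd:
  assumes "packing d" "i < m" "X \<subseteq> J" "forest en X" "\<And>j. j < m \<Longrightarrow> j \<noteq> i \<Longrightarrow> X \<inter> d j = {}"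
  shows "packing (d(i := X))"
  using assms unfolding packing_def by (simp add: Int_commute)

lemma swap_maximum:
  assumes d: "maximum_packing d" and i: "i < m" and e: "e \<in> J - cover d" and g: "g \<in> d i"
    and f: "forest en (insert e (d i - {g}))"
  shows "maximum_packing (d(i := insert e (d i - {g})))" (is "maximum_packing ?d")
    and "g \<notin> cover (d(i := insert e (d i - {g})))"
proof -
  have p: "packing d"
    using d by (simp add: maximum_packing_def)
  have disj: "d i \<inter> d j = {}" if "j < m" "j \<noteq> i" for j
    using p i that by (auto simp: packing_def)
  have p': "packing ?d"
  proof (rule packing_upd[OF p i _ f])
    show "insert e (d i - {g}) \<subseteq> J"
      using p i e by (auto simp: packing_def)
    show "insert e (d i - {g}) \<inter> d j = {}" if "j < m" "j \<noteq> i" for j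
      using disj[OF that] e that by auto
  qed
  have eq: "cover ?d = insert e (cover d - {g})"
    unfolding cover_upd[OF i] using disj i g by fastforce
  have "g \<in> cover d"
    using g i by auto
  then have "card (cover ?d) = card (cover d)"
    unfolding eq using e cover_finite[OF p]
    by (subst card_insert_disjoint) (auto simp: card_Suc_Diff1 simp del: card_Diff_insert)
  then show "maximum_packing ?d"
    using d p' by (simp add: maximum_packing_def)
  show "g \<notin> cover ?d"
    unfolding eq using e \<open>g \<in> cover d\<close> by auto
qed

lemma swappable_maximum:
  assumes "maximum_packing c" "d \<in> swappable c"
  shows "maximum_packing d"
  using assms(2)
proof (induction rule: swappable.induct)
  case (swap d i e g)
  then show ?case
    by (intro swap_maximum(1))
qed (rule assms(1))

lemma maximum_not_forest:
  assumes d: "maximum_packing d" and i: "i < m" and e: "e \<in> J - cover d"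
  shows "\<not> forest en (insert e (d i))"
proof
  assume f: "forest en (insert e (d i))"
  have p: "packing d"
    using d by (simp add: maximum_packing_def)
  have "packing (d(i := insert e (d i)))"
  proof (rule packing_upd[OF p i _ f])
    show "insert e (d i) \<subseteq> J"
      using p i e by (auto simp: packing_def)
    show "insert e (d i) \<inter> d j = {}" if "j < m" "j \<noteq> i" for j
      using p i e that by (auto simp: packing_def)
  qed
  moreover have "cover (d(i := insert e (d i))) = insert e (cover d)"
    unfolding cover_upd[OF i] using i by auto
  ultimately have "card (insert e (cover d)) \<le> card (cover d)"
    using d by (metis maximum_packing_def)
  then show False
    using e cover_finite[OF p] by simp
qed

text \<open>By maximality \<open>e\<close> closes a cycle in the forest \<open>d i\<close>. Every
  edge of the path between its ends can be swapped out for \<open>e\<close>, hence is itself left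
  uncovered by some reachable packing.\<close>

lemma uncovered_edge_reach:
  assumes "maximum_packing c" "d \<in> swappable c" "i < m" "e \<in> J - cover d" "en e = {u, v}"
  shows "(u, v) \<in> reach en (d i \<inter> uncovered c)"
proof -
  have d: "maximum_packing d"
    using swappable_maximum assms by blast
  then have f: "forest en (d i)" and fin: "finite (d i)"
    using assms(3) finite_J by (auto simp: maximum_packing_def packing_def intro: finite_subset)
  have "(u, v) \<in> reach en (d i)"
    using forest_insert[OF f assms(5)] maximum_not_forest[OF d assms(3,4)] by blast
  then have "(u, v) \<in> reach en {g \<in> d i. forest en (insert e (d i - {g}))}"
    using forest_path_edges[OF fin f assms(5)] by blast
  moreover have "{g \<in> d i. forest en (insert e (d i - {g}))} \<subseteq> d i \<inter> uncovered c"
  proof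
    fix g assume "g \<in> {g \<in> d i. forest en (insert e (d i - {g}))}"
    then have g: "g \<in> d i" "forest en (insert e (d i - {g}))"
      by auto
    then have "d(i := insert e (d i - {g})) \<in> swappable c"
      by (intro swappable.swap assms)
    moreover have "g \<notin> cover (d(i := insert e (d i - {g})))"
      by (rule swap_maximum(2)[OF d assms(3,4) g])
    moreover have "g \<in> J"
      using g(1) d assms(3) by (auto simp: maximum_packing_def packing_def)
    ultimately show "g \<in> d i \<inter> uncovered c"
      using g(1) unfolding uncovered_def by blast
  qed
  ultimately show ?thesis
    using reach_mono by blast
qed

text \<open>Along a sequence of swaps no forest gains connections through the edges that some swap
  sequence uncovers, so the connections observed at the end were there at the start.\<close>

lemma uncovered_reach:
  assumes c: "maximum_packing c" and "d \<in> swappable c" and i: "i < m"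
  shows "reach en (d i \<inter> uncovered c) \<subseteq> reach en (c i \<inter> uncovered c)"
  using assms(2)
proof (induction rule: swappable.induct)
  case (swap d j e g)
  have "reach en ((d(j := insert e (d j - {g}))) i \<inter> uncovered c) \<subseteq> reach en (d i \<inter> uncovered c)"
  proof (rule reach_subsetI)
    fix h u v assume h: "h \<in> (d(j := insert e (d j - {g}))) i \<inter> uncovered c" "en h = {u, v}"
    show "(u, v) \<in> reach en (d i \<inter> uncovered c)"
    proof (cases "h = e")
      case True
      then show ?thesis
        using uncovered_edge_reach[OF c swap.hyps(1) i, of h] swap.hyps(3) h(2) by blast
    next
      case False
      then have "h \<in> d i \<inter> uncovered c"
        using h(1) by (auto split: if_splits)
      then show ?thesis
        using h(2) by (rule reach_edge)
    qed
  qed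
  then show ?case
    using swap.IH by blast
qed simp

lemma uncovered_reach_all:
  assumes c: "maximum_packing c" and i: "i < m"
  shows "reach en (uncovered c) \<subseteq> reach en (c i \<inter> uncovered c)"
proof (rule reach_subsetI)
  fix e u v assume "e \<in> uncovered c" and uv: "en e = {u, v}"
  then obtain d where d: "d \<in> swappable c" "e \<in> J - cover d"
    by (auto simp: uncovered_def)
  show "(u, v) \<in> reach en (c i \<inter> uncovered c)"
    using uncovered_edge_reach[OF c d(1) i d(2) uv] uncovered_reach[OF c d(1) i] by blast
qed

text \<open>A walk along \<open>A\<close> that starts in a class of the coarser relation
  \<open>reach en B\<close> never leaves this class.\<close>

lemma reach_within_class:
  assumes "A \<subseteq> B" "(a, b) \<in> reach en A" "(u, a) \<in> reach en B"
  shows "(a, b) \<in> reach en (within en A (reach en B `` {u}))"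
  using assms(2) unfolding reach_def[of en A]
proof (induction rule: rtrancl_induct)
  case (step b c)
  then obtain h where h: "h \<in> A" "en h = {b, c}"
    by auto
  have "(a, b) \<in> reach en A"
    using step.hyps(1) by (simp add: reach_def)
  then have "(u, b) \<in> reach en B"
    using reach_mono[OF assms(1)] assms(3) reach_trans[of u a en B b] by blast
  moreover have "(b, c) \<in> reach en B"
    using h assms(1) reach_edge[of h B en b c] by blast
  ultimately have "h \<in> within en A (reach en B `` {u})"
    using h reach_trans[of u b en B c] by (simp add: within_def)
  then have "(b, c) \<in> reach en (within en A (reach en B `` {u}))"
    using h(2) by (rule reach_edge)
  then show ?case
    using step.IH by (rule reach_trans[rotated])
qed simp

lemma maximum_packing_exists: "\<exists>c. maximum_packing c"
proof -
  have "packing (\<lambda>_. {})"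
    by (simp add: packing_def forest_def)
  moreover have "card (cover d) < Suc (card J)" if "packing d" for d
    using that finite_J by (intro le_imp_less_Suc card_mono) (auto simp: packing_def)
  ultimately show ?thesis
    unfolding maximum_packing_def by (intro ex_has_greatest_nat[of packing "\<lambda>_. {}"]) auto
qed

lemma finite_reach_class: "B \<subseteq> J \<Longrightarrow> finite (reach en B `` {u})"
proof -
  assume B: "B \<subseteq> J"
  have "reach en B `` {u} \<subseteq> insert u (\<Union>e \<in> B. en e)"
  proof
    fix v assume "v \<in> reach en B `` {u}"
    then have "(u, v) \<in> reach en B"
      by simp
    then show "v \<in> insert u (\<Union>e \<in> B. en e)"
      unfolding reach_def by (induction rule: rtrancl_induct) auto
  qed
  moreover have "finite (en e)" if "e \<in> B" for e
    using card_en[of e] that B by (metis card.infinite subsetD zero_neq_numeral)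
  ultimately show ?thesis
    using finite_subset[OF B finite_J] by (meson finite_UN_I finite_insert finite_subset)
qed

text \<open>The forest version of the Nash-Williams theorem. If a maximum packing misses
  \<open>e\<close>, let \<open>U\<close> be the class of an end of \<open>e\<close> under the
  uncoverable edges. Each of the \<open>m\<close> forests induces a spanning tree on
  \<open>U\<close>, so together with \<open>e\<close> there are m(|U| - 1) + 1 edges inside
  \<open>U\<close>, against sparsity.\<close>

theorem sparse_decomposition:
  assumes "sparse m en J"
  obtains c where "packing c" "cover c = J"
proof -
  obtain c where c: "maximum_packing c"
    using maximum_packing_exists by blast
  then have p: "packing c"
    by (simp add: maximum_packing_def)
  have "J \<subseteq> cover c"
  proof (rule ccontr)
    assume "\<not> J \<subseteq> cover c"
    then obtain e where e: "e \<in> J" "e \<notin> cover c"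
      by blast
    obtain u v where uv: "en e = {u, v}"
      using card_en[OF e(1)] by (meson card_2_iff)
    have sub: "uncovered c \<subseteq> J"
      by (auto simp: uncovered_def)
    have eu: "e \<in> uncovered c"
      using e swappable.start by (auto simp: uncovered_def)
    define U where "U = reach en (uncovered c) `` {u}"
    have U: "finite U" "u \<in> U" "en e \<subseteq> U"
      using finite_reach_class[OF sub] uv reach_edge[of e _ en u v, OF eu uv] by (auto simp: U_def)
    have ci: "c i \<subseteq> J" "forest en (c i)" if "i < m" for i
      using p that by (auto simp: packing_def)
    have card_i: "card (within en (c i) U) = card U - 1" if i: "i < m" for i
    proof -
      have "U \<times> U \<subseteq> reach en (within en (c i) U)"
      proof clarify
        fix a b assume ab: "a \<in> U" "b \<in> U"
        then have ua: "(u, a) \<in> reach en (uncovered c)" and ub: "(u, b) \<in> reach en (uncovered c)"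
          by (simp_all add: U_def)
        have "(a, b) \<in> reach en (c i \<inter> uncovered c)"
          using uncovered_reach_all[OF c i] reach_trans[OF reach_sym[OF ua] ub] by blast
        then have "(a, b) \<in> reach en (within en (c i \<inter> uncovered c) U)"
          unfolding U_def using ua by (intro reach_within_class) auto
        then show "(a, b) \<in> reach en (within en (c i) U)"
          using reach_mono[OF within_mono[of "c i \<inter> uncovered c" "c i" U U en]] by blast
      qed
      moreover have "finite (within en (c i) U)" "forest en (within en (c i) U)"
        using finite_subset[OF subset_trans[OF within_subset[of en "c i" U] ci(1)[OF i]] finite_J]
          forest_subset[OF ci(2)[OF i] within_subset[of en "c i" U]] by simp_all
      moreover have "en h \<subseteq> U \<and> card (en h) = 2" if "h \<in> within en (c i) U" for h
        using that ci(1)[OF i] card_en by (auto simp: within_def)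
      moreover have "U \<noteq> {}"
        using U by blast
      ultimately show ?thesis
        using forest_connected_iff_card[of U "within en (c i) U" en] U(1) by blast
    qed
    have "card (\<Union>i < m. within en (c i) U) = (\<Sum>i < m. card (within en (c i) U))"
      using p finite_subset[OF _ finite_J]
      by (intro card_UN_disjoint) (auto simp: packing_def within_def disjoint_iff intro: finite_subset)
    also have "\<dots> = m * (card U - 1)"
      using card_i by simp
    finally have "card (insert e (\<Union>i < m. within en (c i) U)) = Suc (m * (card U - 1))"
      using e finite_subset[OF _ finite_J] ci
      by (subst card_insert_disjoint) (auto simp: within_def intro: finite_subset)
    moreover have "insert e (\<Union>i < m. within en (c i) U) \<subseteq> within en J U"
      using e U ci by (auto simp: within_def)
    ultimately have "Suc (m * (card U - 1)) \<le> card (within en J U)"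
      using card_mono[of "within en J U"] finite_subset[OF within_subset finite_J] by metis
    moreover have "card (within en J U) \<le> m * (card U - 1)"
      using assms U by (auto simp: sparse_def)
    ultimately show False
      by simp
  qed
  moreover have "cover c \<subseteq> J"
    using p by (auto simp: packing_def)
  ultimately show ?thesis
    using that p by blast
qed

end

section \<open>The matroid of sparse edge sets\<close>

text \<open>The common core of tight sets and of tree-connected sets: as intersecting members have
  their union as a member, the maximal members partition \<open>V\<close>. It is used with
  \<open>tight I\<close> for the augmentation axiom and with \<open>tc A\<close> for
  components.\<close>

locale union_closed =
  fixes V :: "'v set" and Q :: "'v set \<Rightarrow> bool"
  assumes finite_V: "finite V"
    and Q_subset: "Q C \<Longrightarrow> C \<subseteq> V"
    and Q_singleton: "u \<in> V \<Longrightarrow> Q {u}"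
    and Q_Un: "Q C \<Longrightarrow> Q D \<Longrightarrow> C \<inter> D \<noteq> {} \<Longrightarrow> Q (C \<union> D)"
begin

definition hull :: "'v \<Rightarrow> 'v set" where
  "hull u = \<Union>{C. Q C \<and> u \<in> C}"

lemma subset_hull: "Q C \<Longrightarrow> u \<in> C \<Longrightarrow> C \<subseteq> hull u"
  unfolding hull_def by (rule Union_upper) simp

lemma hull_Q:
  assumes "u \<in> V"
  shows "Q (hull u)"
proof -
  have "finite {C. Q C \<and> u \<in> C}"
    by (rule finite_subset[of _ "Pow V"]) (auto simp: finite_V dest: Q_subset)
  moreover have "{C. Q C \<and> u \<in> C} \<noteq> {}"
    using Q_singleton[OF assms] by blast
  ultimately obtain M where M: "Q M" "u \<in> M" and max: "\<And>C. Q C \<Longrightarrow> u \<in> C \<Longrightarrow> M \<subseteq> C \<Longrightarrow> M = C"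
    by (metis (mono_tags, lifting) finite_has_maximal mem_Collect_eq)
  have "C \<subseteq> M" if "Q C" "u \<in> C" for C
    using max[of "M \<union> C"] Q_Un[of M C] M that by blast
  then have "hull u = M"
    unfolding hull_def using M by blast
  then show ?thesis
    using M by simp
qed

lemma in_hull: "u \<in> V \<Longrightarrow> u \<in> hull u"
  using Q_singleton subset_hull by blast

lemma hull_eqI:
  assumes "u \<in> V" "Q C" "v \<in> C" "C \<inter> hull u \<noteq> {}"
  shows "hull v = hull u"
proof -
  have v: "v \<in> V"
    using assms Q_subset by blast
  have "Q (C \<union> hull u)"
    using Q_Un[OF assms(2) hull_Q[OF assms(1)] assms(4)] .
  then have "C \<union> hull u \<subseteq> hull u" "C \<union> hull u \<subseteq> hull v"
    using in_hull[OF assms(1)] assms(3) by (auto dest: subset_hull)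
  then have "Q (hull v \<union> hull u)" "v \<in> hull u"
    using Q_Un[OF hull_Q[OF v] hull_Q[OF assms(1)]] in_hull[OF v] assms(3) by blast+
  then show ?thesis
    using \<open>C \<union> hull u \<subseteq> hull v\<close> in_hull[OF assms(1)] by (auto dest: subset_hull)
qed

lemma hull_eq: "u \<in> V \<Longrightarrow> v \<in> hull u \<Longrightarrow> hull v = hull u"
  using hull_eqI[of u "hull u" v] hull_Q by blast

lemma hull_disjoint: "u \<in> V \<Longrightarrow> v \<in> V \<Longrightarrow> hull u \<noteq> hull v \<Longrightarrow> hull u \<inter> hull v = {}"
  using hull_eq by (metis disjoint_iff)

definition parts :: "'v set set" where
  "parts = hull ` V"

lemma finite_parts: "finite parts"
  by (simp add: parts_def finite_V)

lemma parts_disjoint: "p \<in> parts \<Longrightarrow> q \<in> parts \<Longrightarrow> p \<noteq> q \<Longrightarrow> p \<inter> q = {}"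
  using hull_disjoint by (auto simp: parts_def)

lemma Union_parts: "\<Union>parts = V"
  using hull_Q Q_subset in_hull by (fastforce simp: parts_def)

lemma parts_Q: "p \<in> parts \<Longrightarrow> Q p"
  using hull_Q by (auto simp: parts_def)

lemma parts_nonempty: "p \<in> parts \<Longrightarrow> p \<noteq> {}"
  using in_hull by (auto simp: parts_def)

lemma finite_part: "p \<in> parts \<Longrightarrow> finite p"
  by (rule finite_subset[OF Q_subset[OF parts_Q] finite_V])

lemma Q_subset_part: "Q C \<Longrightarrow> C \<noteq> {} \<Longrightarrow> \<exists>p \<in> parts. C \<subseteq> p"
  using Q_subset[of C] subset_hull[of C] unfolding parts_def by blast

lemma parts_maximal: "p \<in> parts \<Longrightarrow> Q C \<Longrightarrow> C \<inter> p \<noteq> {} \<Longrightarrow> C \<subseteq> p"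
  using parts_disjoint[of _ p] Q_subset_part[of C] by blast

lemma sum_parts: "(\<Sum>p \<in> parts. m * (card p - 1)) + m * card parts = m * card V"
proof -
  have "card V = (\<Sum>p \<in> parts. card p)"
    using card_Union_disjoint[of parts] parts_disjoint finite_part Union_parts
    by (simp add: pairwise_def disjnt_def)
  moreover have "m * (card p - 1) + m = m * card p" if "p \<in> parts" for p
    using parts_nonempty[OF that] finite_part[OF that] by (cases "card p") auto
  then have "(\<Sum>p \<in> parts. m * (card p - 1) + m) = (\<Sum>p \<in> parts. m * card p)"
    by (intro sum.cong) auto
  ultimately show ?thesis
    by (simp add: sum.distrib sum_distrib_left mult.commute)
qed

lemma card_edges_parts:
  assumes "finite A" "\<And>e. e \<in> A \<Longrightarrow> en e \<noteq> {}"
  shows "card A = (\<Sum>p \<in> parts. card (within en A p)) + card {e \<in> A. \<forall>p \<in> parts. \<not> en e \<subseteq> p}"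
proof -
  let ?X = "{e \<in> A. \<forall>p \<in> parts. \<not> en e \<subseteq> p}"
  have "card (\<Union>p \<in> parts. within en A p) = (\<Sum>p \<in> parts. card (within en A p))"
  proof (rule card_UN_disjoint)
    show "\<forall>p \<in> parts. \<forall>q \<in> parts. p \<noteq> q \<longrightarrow> within en A p \<inter> within en A q = {}"
    proof (intro ballI impI)
      fix p q assume "p \<in> parts" "q \<in> parts" "p \<noteq> q"
      then show "within en A p \<inter> within en A q = {}"
        using parts_disjoint[of p q] assms(2) unfolding within_def by blast
    qed
  qed (auto simp: finite_parts assms(1) within_def)
  moreover have "A = (\<Union>p \<in> parts. within en A p) \<union> ?X"
    by (auto simp: within_def)
  moreover have "(\<Union>p \<in> parts. within en A p) \<inter> ?X = {}"
    by (auto simp: within_def)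
  ultimately show ?thesis
    using assms(1) by (metis (no_types, lifting) card_Un_disjoint finite_Un)
qed

end

section \<open>Tight sets and the augmentation axiom\<close>

locale graph_sparsity = multigraph G for G :: "('v, 'e) mgraph" +
  fixes m :: nat
begin

abbreviation "V \<equiv> vertices G"
abbreviation "E \<equiv> edges G"
abbreviation "en \<equiv> ends G"

lemma finite_subV: "C \<subseteq> V \<Longrightarrow> finite C"
  using finite_vertices finite_subset by blast

lemma finite_subE: "A \<subseteq> E \<Longrightarrow> finite A"
  using finite_edges finite_subset by blast

lemma finite_within: "A \<subseteq> E \<Longrightarrow> finite (within en A C)"
  by (rule finite_subset[OF within_subset finite_subE])

lemma ends_nonempty: "e \<in> E \<Longrightarrow> en e \<noteq> {}"
  using card_ends by fastforce

lemma sparse_subset: "sparse m en I \<Longrightarrow> J \<subseteq> I \<Longrightarrow> I \<subseteq> E \<Longrightarrow> sparse m en J"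
  unfolding sparse_def by (meson card_mono[OF finite_within] order_trans subset_refl within_mono)

lemma sparse_cardD: "sparse m en I \<Longrightarrow> C \<subseteq> V \<Longrightarrow> C \<noteq> {} \<Longrightarrow> card (within en I C) \<le> m * (card C - 1)"
  unfolding sparse_def using finite_subV by blast

definition tight :: "'e set \<Rightarrow> 'v set \<Rightarrow> bool" where
  "tight I C \<longleftrightarrow> C \<noteq> {} \<and> C \<subseteq> V \<and> card (within en I C) = m * (card C - 1)"

lemma card_within_Un:
  assumes "A \<subseteq> E"
  shows "card (within en A C) + card (within en A D) \<le> card (within en A (C \<union> D)) + card (within en A (C \<inter> D))"
proof -
  have "within en A C \<inter> within en A D = within en A (C \<inter> D)"
    by (auto simp: within_def)
  moreover have "within en A C \<union> within en A D \<subseteq> within en A (C \<union> D)"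
    by (auto simp: within_def)
  ultimately show ?thesis
    using card_Un_Int[of "within en A C" "within en A D"] finite_within[OF assms]
      card_mono[of "within en A (C \<union> D)" "within en A C \<union> within en A D"] by simp
qed

text \<open>The number of edges inside a set is supermodular, while m(|C| - 1) is modular on
  intersecting pairs; hence both the union and the intersection must attain the bound.\<close>

lemma tight_Un:
  assumes "I \<subseteq> E" "sparse m en I" "tight I C" "tight I D" "C \<inter> D \<noteq> {}"
  shows "tight I (C \<union> D)"
proof -
  have fin: "finite C" "finite D"
    using assms finite_subV by (auto simp: tight_def)
  have pos: "card C > 0" "card D > 0" "card (C \<inter> D) > 0" "card (C \<union> D) > 0"
    using fin assms(5) by (auto simp: card_gt_0_iff)
  have "card C + card D = card (C \<union> D) + card (C \<inter> D)"
    using fin by (rule card_Un_Int)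
  then have "(card C - 1) + (card D - 1) = (card (C \<union> D) - 1) + (card (C \<inter> D) - 1)"
    using pos by linarith
  then have "m * (card C - 1) + m * (card D - 1) = m * (card (C \<union> D) - 1) + m * (card (C \<inter> D) - 1)"
    by (metis distrib_left)
  moreover have "card (within en I (C \<union> D)) \<le> m * (card (C \<union> D) - 1)"
      "card (within en I (C \<inter> D)) \<le> m * (card (C \<inter> D) - 1)"
    using assms(3-5) sparse_cardD[OF assms(2)] unfolding tight_def by (metis le_infI1 le_sup_iff sup_eq_bot_iff)+
  ultimately show ?thesis
    using card_within_Un[OF assms(1), of C D] assms(3,4) by (auto simp: tight_def)
qed

lemma tight_singleton:
  assumes "I \<subseteq> E" "u \<in> V"
  shows "tight I {u}"
proof -
  have "\<not> en e \<subseteq> {u}" if "e \<in> I" for e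
    using card_ends[of e] assms(1) that card_mono[of "{u}" "en e"] by auto
  then have "within en I {u} = {}"
    by (auto simp: within_def)
  then show ?thesis
    using assms(2) by (simp add: tight_def)
qed

lemma tight_union_closed: "I \<subseteq> E \<Longrightarrow> sparse m en I \<Longrightarrow> union_closed V (tight I)"
  by unfold_locales (auto simp: finite_vertices tight_singleton tight_Un, auto simp: tight_def)

lemma not_sparse_insert:
  assumes "I \<subseteq> E" "sparse m en I" "e \<in> E" "\<not> sparse m en (insert e I)"
  obtains C where "tight I C" "en e \<subseteq> C"
proof -
  obtain C where C: "finite C" "C \<noteq> {}" "card (within en (insert e I) C) > m * (card C - 1)"
    using assms(4) by (auto simp: sparse_def not_le)
  have le: "card (within en I C) \<le> m * (card C - 1)"
    using assms(2) C by (auto simp: sparse_def)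
  have eC: "en e \<subseteq> C"
  proof (rule ccontr)
    assume "\<not> en e \<subseteq> C"
    then have "within en (insert e I) C = within en I C"
      by (auto simp: within_def)
    then show False
      using C le by simp
  qed
  then have "within en (insert e I) C = insert e (within en I C)"
    by (auto simp: within_def)
  then have "card (within en (insert e I) C) \<le> Suc (card (within en I C))"
    using card_insert_le_m1 by (simp add: card_insert_if finite_within[OF assms(1)])
  then have eq: "card (within en I C) = m * (card C - 1)"
    using C le by simp
  \<comment> \<open>Sparsity also speaks about sets not contained in \<open>V\<close>. Cutting
    \<open>C\<close> down to \<open>V\<close> loses no edge and does not increase the bound, so
    tightness survives.\<close>
  have I: "within en I (C \<inter> V) = within en I C"
    using ends_subset assms(1) by (auto simp: within_def)
  have ne: "C \<inter> V \<noteq> {}"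
    using eC ends_subset[OF assms(3)] ends_nonempty[OF assms(3)] by blast
  have "card (within en I (C \<inter> V)) \<le> m * (card (C \<inter> V) - 1)"
    using ne by (intro sparse_cardD assms) auto
  moreover have "m * (card (C \<inter> V) - 1) \<le> m * (card C - 1)"
    using card_mono[of C "C \<inter> V"] C by (intro mult_le_mono2 diff_le_mono) auto
  ultimately have "tight I (C \<inter> V)"
    using I eq ne unfolding tight_def by (metis Int_lower2 order_antisym)
  then show ?thesis
    using that eC ends_subset[OF assms(3)] by blast
qed

text \<open>If no edge of \<open>J\<close> extends \<open>I\<close>, compare both sets along the
  partition into maximal tight sets of \<open>I\<close>. Inside a part \<open>I\<close> attains the
  bound that \<open>J\<close> obeys, and an edge of \<open>J\<close> inside no part already belongs
  to \<open>I\<close>. So \<open>J\<close> cannot be larger.\<close>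

lemma sparse_augment:
  assumes "I \<subseteq> E" "J \<subseteq> E" "sparse m en I" "sparse m en J" "card I < card J"
  shows "\<exists>e \<in> J - I. sparse m en (insert e I)"
proof (rule ccontr)
  assume no: "\<not> ?thesis"
  interpret tight: union_closed V "tight I"
    using tight_union_closed assms by blast
  have IJ: "finite I" "finite J" "\<And>e. e \<in> I \<Longrightarrow> en e \<noteq> {}" "\<And>e. e \<in> J \<Longrightarrow> en e \<noteq> {}"
    using assms finite_subE ends_nonempty by blast+
  have "card J = (\<Sum>p \<in> tight.parts. card (within en J p)) + card {e \<in> J. \<forall>p \<in> tight.parts. \<not> en e \<subseteq> p}"
    using IJ by (intro tight.card_edges_parts)
  also have "\<dots> \<le> (\<Sum>p \<in> tight.parts. card (within en I p)) + card {e \<in> I. \<forall>p \<in> tight.parts. \<not> en e \<subseteq> p}"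
  proof (rule add_mono[OF sum_mono card_mono])
    fix p assume "p \<in> tight.parts"
    then have "tight I p"
      by (rule tight.parts_Q)
    then show "card (within en J p) \<le> card (within en I p)"
      using sparse_cardD[OF assms(4), of p] by (auto simp: tight_def)
  next
    have "e \<in> I" if e: "e \<in> J" "\<forall>p \<in> tight.parts. \<not> en e \<subseteq> p" for e
    proof (rule ccontr)
      assume "e \<notin> I"
      then obtain C where "tight I C" "en e \<subseteq> C"
        using no e not_sparse_insert[OF assms(1,3), of e] assms(2) by blast
      then show False
        using tight.Q_subset_part[of C] e(2) unfolding tight_def by blast
    qed
    then show "{e \<in> J. \<forall>p \<in> tight.parts. \<not> en e \<subseteq> p} \<subseteq> {e \<in> I. \<forall>p \<in> tight.parts. \<not> en e \<subseteq> p}"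
      by blast
  qed (simp add: IJ)
  also have "\<dots> = card I"
    using IJ by (intro tight.card_edges_parts[symmetric])
  finally show False
    using assms(5) by simp
qed

end

section \<open>Tree-connected vertex sets\<close>

context graph_sparsity
begin

sublocale finite_matroid E "sparse m en"
proof
  show "sparse m en {}"
    by (simp add: sparse_def within_def)
qed (auto intro: sparse_augment sparse_subset simp: finite_edges)

lemma within_sub: "A \<subseteq> E \<Longrightarrow> within en A C \<subseteq> E"
  by (auto simp: within_def)

lemma rank_within_le:
  assumes "A \<subseteq> E" "C \<noteq> {}" "C \<subseteq> V"
  shows "rank (within en A C) \<le> m * (card C - 1)"
proof -
  obtain I where I: "I \<subseteq> within en A C" "sparse m en I" "card I = rank (within en A C)"
    using rank_attained[OF within_sub[OF assms(1)]] .
  then have "within en I C = I"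
    by (auto simp: within_def)
  then show ?thesis
    using sparse_cardD[OF I(2) assms(3,2)] I(3) by simp
qed

text \<open>The subgraph with edge set \<open>A\<close> induced on \<open>C\<close> is \<open>m\<close>-tree-connected; see \<open>tc_iff_packs\<close>.\<close>

definition tc :: "'e set \<Rightarrow> 'v set \<Rightarrow> bool" where
  "tc A C \<longleftrightarrow> C \<noteq> {} \<and> C \<subseteq> V \<and> rank (within en A C) = m * (card C - 1)"

text \<open>Disjoint connecting edge sets instead of trees: they can be combined without restoring
  acyclicity, as in \<open>tc_Un\<close>, and \<open>packs_forests\<close> thins them out to
  forests.\<close>

definition packs :: "'e set \<Rightarrow> 'v set \<Rightarrow> bool" where
  "packs A C \<longleftrightarrow> C \<noteq> {} \<and> C \<subseteq> V \<and>
    (\<exists>c. (\<forall>i < m. c i \<subseteq> within en A C \<and> C \<times> C \<subseteq> reach en (c i)) \<and>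
      (\<forall>i < m. \<forall>j < m. i \<noteq> j \<longrightarrow> c i \<inter> c j = {}))"

lemma packs_forests:
  assumes "A \<subseteq> E" "packs A C"
  obtains c where "\<And>i. i < m \<Longrightarrow> c i \<subseteq> within en A C" "\<And>i. i < m \<Longrightarrow> forest en (c i)"
    "\<And>i. i < m \<Longrightarrow> C \<times> C \<subseteq> reach en (c i)" "\<And>i j. i < m \<Longrightarrow> j < m \<Longrightarrow> i \<noteq> j \<Longrightarrow> c i \<inter> c j = {}"
proof -
  obtain d where d: "\<And>i. i < m \<Longrightarrow> d i \<subseteq> within en A C" "\<And>i. i < m \<Longrightarrow> C \<times> C \<subseteq> reach en (d i)"
    and disj: "\<And>i j. i < m \<Longrightarrow> j < m \<Longrightarrow> i \<noteq> j \<Longrightarrow> d i \<inter> d j = {}"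
    using assms(2) unfolding packs_def by metis
  have "\<exists>B. i < m \<longrightarrow> B \<subseteq> d i \<and> forest en B \<and> C \<times> C \<subseteq> reach en B" for i
    using spanning_forest_exists[of "d i" C en] d[of i] finite_subset[OF _ finite_within[OF assms(1), of C]]
    by metis
  then obtain c where c: "\<And>i. i < m \<Longrightarrow> c i \<subseteq> d i \<and> forest en (c i) \<and> C \<times> C \<subseteq> reach en (c i)"
    by metis
  show ?thesis
  proof (rule that)
    show "c i \<inter> c j = {}" if "i < m" "j < m" "i \<noteq> j" for i j
      using disj[OF that] c that by blast
  qed (use c d in blast)+
qed

lemma forest_within_card:
  assumes "A \<subseteq> E" "forest en A" "finite D" "D \<noteq> {}"
  shows "card (within en A D) \<le> card D - 1"
proof (rule forest_card_le)
  show "forest en (within en A D)"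
    by (rule forest_subset[OF assms(2) within_subset])
  show "en e \<subseteq> D \<and> card (en e) = 2" if "e \<in> within en A D" for e
    using that assms(1) card_ends by (auto simp: within_def)
qed (auto simp: assms finite_within)

text \<open>The union of \<open>m\<close> disjoint spanning trees of \<open>C\<close> has m(|C| - 1)
  edges and is sparse, because each forest has at most |D| - 1 edges inside any nonempty finite
  \<open>D\<close>.\<close>

lemma packs_imp_tc:
  assumes "A \<subseteq> E" "packs A C"
  shows "tc A C"
proof -
  have C: "C \<noteq> {}" "C \<subseteq> V"
    using assms(2) by (auto simp: packs_def)
  obtain c where c: "\<And>i. i < m \<Longrightarrow> c i \<subseteq> within en A C" "\<And>i. i < m \<Longrightarrow> forest en (c i)"
    "\<And>i. i < m \<Longrightarrow> C \<times> C \<subseteq> reach en (c i)" "\<And>i j. i < m \<Longrightarrow> j < m \<Longrightarrow> i \<noteq> j \<Longrightarrow> c i \<inter> c j = {}"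
    by (rule packs_forests[OF assms]) blast
  have cE: "c i \<subseteq> E" "finite (c i)" if "i < m" for i
    using c(1)[OF that] within_sub[OF assms(1), of C] finite_subE by (meson order_trans)+
  have card_c: "card (c i) = card C - 1" if "i < m" for i
  proof -
    have "en e \<subseteq> C \<and> card (en e) = 2" if "e \<in> c i" for e
      using c(1)[OF \<open>i < m\<close>] cE(1)[OF \<open>i < m\<close>] that card_ends by (auto simp: within_def)
    then show ?thesis
      using forest_connected_iff_card[of C "c i" en] c(2,3) cE(2) that C finite_subV by blast
  qed
  let ?I = "\<Union>i < m. c i"
  have "sparse m en ?I"
    unfolding sparse_def
  proof (intro allI impI)
    fix D :: "'v set" assume D: "finite D \<and> D \<noteq> {}"
    have "within en ?I D = (\<Union>i < m. within en (c i) D)"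
      by (auto simp: within_def)
    then have "card (within en ?I D) \<le> (\<Sum>i < m. card (within en (c i) D))"
      by (simp add: card_UN_le)
    also have "\<dots> \<le> (\<Sum>i < m. card D - 1)"
      using D cE(1) c(2) forest_within_card by (intro sum_mono) auto
    finally show "card (within en ?I D) \<le> m * (card D - 1)"
      by simp
  qed
  moreover have "?I \<subseteq> within en A C"
    using c(1) by blast
  ultimately have "card ?I \<le> rank (within en A C)"
    by (intro card_le_rank within_sub assms(1))
  moreover have "card ?I = (\<Sum>i < m. card (c i))"
    using c(4) cE(2) by (intro card_UN_disjoint) auto
  ultimately show ?thesis
    using C card_c rank_within_le[OF assms(1) C] by (simp add: tc_def)
qed

text \<open>A basis of m(|C| - 1) edges splits into \<open>m\<close> forests with at most |C| - 1
  edges each; all must attain this number, and then they connect \<open>C\<close>.\<close>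

lemma tc_imp_packs:
  assumes "A \<subseteq> E" "tc A C"
  shows "packs A C"
proof -
  have C: "C \<noteq> {}" "C \<subseteq> V" "finite C"
    using assms(2) finite_subV by (auto simp: tc_def)
  obtain I where I: "I \<subseteq> within en A C" "sparse m en I" "card I = rank (within en A C)"
    using rank_attained[OF within_sub[OF assms(1)]] .
  have IE: "I \<subseteq> E"
    using I(1) within_sub[OF assms(1)] by blast
  interpret forest_packing m en I
    using finite_subE[OF IE] card_ends IE by unfold_locales auto
  obtain c where c: "packing c" "cover c = I"
    by (rule sparse_decomposition[OF I(2)])
  have ci: "c i \<subseteq> I" "c i \<subseteq> E" "finite (c i)" "forest en (c i)" if "i < m" for i
    using c(1) that IE finite_subE[of "c i"] by (auto simp: packing_def)
  have in_C: "en e \<subseteq> C \<and> card (en e) = 2" if "i < m" "e \<in> c i" for i e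
    using ci(1,2)[OF that(1)] that(2) I(1) card_ends by (auto simp: within_def)
  have le: "card (c i) \<le> card C - 1" if "i < m" for i
    using forest_card_le[of C "c i" en] C ci[OF that] in_C[OF that] by blast
  have "(\<Sum>i < m. card (c i)) = card I"
    unfolding c(2)[symmetric] using c(1) ci by (intro card_UN_disjoint[symmetric]) (auto simp: packing_def)
  also have "\<dots> = (\<Sum>i < m. card C - 1)"
    using I(3) assms(2) by (simp add: tc_def)
  finally have "card (c i) = card C - 1" if "i < m" for i
    using le that by (intro sum_mono_inv[of "\<lambda>i. card (c i)" "{..<m}"]) auto
  then have "C \<times> C \<subseteq> reach en (c i)" if "i < m" for i
    using forest_connected_iff_card[of C "c i" en] C ci[OF that] in_C[OF that] that by blast
  then show ?thesis
    unfolding packs_def using C(1,2) c(1) subset_trans[OF ci(1) I(1)]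
    by (intro conjI exI[of _ c]) (auto simp: packing_def)
qed

lemma tc_iff_packs: "A \<subseteq> E \<Longrightarrow> tc A C \<longleftrightarrow> packs A C"
  using tc_imp_packs packs_imp_tc by blast

lemma tc_Un:
  assumes A: "A \<subseteq> E" and "tc A C" "tc A D" "C \<inter> D \<noteq> {}"
  shows "tc A (C \<union> D)"
proof -
  have "packs A C" "packs A D"
    using assms tc_iff_packs by auto
  then have CD: "C \<noteq> {}" "C \<subseteq> V" "D \<subseteq> V"
    by (simp_all add: packs_def)
  obtain c where c: "\<And>i. i < m \<Longrightarrow> c i \<subseteq> within en A C" "\<And>i. i < m \<Longrightarrow> C \<times> C \<subseteq> reach en (c i)"
      "\<And>i j. i < m \<Longrightarrow> j < m \<Longrightarrow> i \<noteq> j \<Longrightarrow> c i \<inter> c j = {}"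
    using \<open>packs A C\<close> unfolding packs_def by metis
  obtain d where d: "\<And>i. i < m \<Longrightarrow> d i \<subseteq> within en A D" "\<And>i. i < m \<Longrightarrow> D \<times> D \<subseteq> reach en (d i)"
      "\<And>i j. i < m \<Longrightarrow> j < m \<Longrightarrow> i \<noteq> j \<Longrightarrow> d i \<inter> d j = {}"
    using \<open>packs A D\<close> unfolding packs_def by metis
  obtain z where z: "z \<in> C" "z \<in> D"
    using assms(4) by blast
  \<comment> \<open>Edges of \<open>d i\<close> inside \<open>C\<close> are replaced by connections
    through \<open>c i\<close>. The edges retained from \<open>d\<close> do not lie inside
    \<open>C\<close>, so they cannot collide with any \<open>c j\<close>.\<close>
  define h where "h i = c i \<union> (d i - within en A C)" for i
  have "h i \<subseteq> within en A (C \<union> D)" if "i < m" for i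
    using c(1)[OF that] d(1)[OF that] by (auto simp: h_def within_def)
  moreover have "(C \<union> D) \<times> (C \<union> D) \<subseteq> reach en (h i)" if i: "i < m" for i
  proof -
    have RC: "C \<times> C \<subseteq> reach en (h i)"
      using c(2)[OF i] reach_mono[of "c i" "h i" en] by (auto simp: h_def)
    have "reach en (d i) \<subseteq> reach en (h i)"
    proof (rule reach_subsetI)
      fix e u v assume e: "e \<in> d i" "en e = {u, v}"
      show "(u, v) \<in> reach en (h i)"
      proof (cases "e \<in> within en A C")
        case True
        then have "u \<in> C" "v \<in> C"
          using e(2) by (auto simp: within_def)
        then show ?thesis
          using RC by blast
      next
        case False
        then have "e \<in> h i"
          using e(1) by (simp add: h_def)
        then show ?thesis
          using e(2) by (rule reach_edge)
      qed
    qed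
    then have RD: "D \<times> D \<subseteq> reach en (h i)"
      using d(2)[OF i] by blast
    show ?thesis
    proof clarify
      fix a b assume "a \<in> C \<union> D" "b \<in> C \<union> D"
      then have "(a, z) \<in> reach en (h i)" "(z, b) \<in> reach en (h i)"
        using RC RD z by auto
      then show "(a, b) \<in> reach en (h i)"
        by (rule reach_trans)
    qed
  qed
  moreover have "h i \<inter> h j = {}" if "i < m" "j < m" "i \<noteq> j" for i j
    using c(1)[OF that(1)] c(1)[OF that(2)] c(3)[OF that] d(3)[OF that]
    by (auto simp: h_def)
  ultimately have "packs A (C \<union> D)"
    unfolding packs_def using CD by (intro conjI exI[of _ h]) auto
  then show ?thesis
    using A tc_iff_packs by blast
qed

lemma tc_singleton: "A \<subseteq> E \<Longrightarrow> u \<in> V \<Longrightarrow> tc A {u}"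
  using rank_within_le[of A "{u}"] by (simp add: tc_def)

lemma tc_mono:
  assumes "A \<subseteq> B" "B \<subseteq> E" "tc A C"
  shows "tc B C"
proof -
  have "rank (within en A C) \<le> rank (within en B C)"
    using assms by (intro rank_mono within_mono within_sub) auto
  then show ?thesis
    using assms rank_within_le[of B C] by (auto simp: tc_def)
qed

lemma tc_union_closed: "A \<subseteq> E \<Longrightarrow> union_closed V (tc A)"
  by unfold_locales (auto simp: finite_vertices tc_singleton tc_Un, auto simp: tc_def)

text \<open>\<open>A\<close> already has the largest possible rank inside \<open>C\<close>, so
  further edges of \<open>G\<close> inside \<open>C\<close> cannot increase it.\<close>

lemma within_subset_span:
  assumes "A \<subseteq> E" "tc A C"
  shows "within en E C \<subseteq> span A"
proof -
  have "rank (within en A C) = rank (within en E C)"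
    using tc_mono[OF assms(1) order_refl assms(2)] assms(2) by (simp add: tc_def)
  then have "within en E C \<subseteq> span (within en A C)"
    using assms(1) by (intro span_rank_eq within_mono within_sub) auto
  then show ?thesis
    using span_mono[OF within_subset[of en A C] assms(1)] by blast
qed

lemma tight_imp_tc:
  assumes "A \<subseteq> E" "I \<subseteq> A" "sparse m en I" "tight I C"
  shows "tc A C"
proof -
  have "sparse m en (within en I C)"
    using assms by (intro sparse_subset[OF assms(3) within_subset]) auto
  then have "card (within en I C) \<le> rank (within en A C)"
    using assms by (intro card_le_rank within_sub within_mono) auto
  then show ?thesis
    using assms rank_within_le[OF assms(1), of C] by (auto simp: tc_def tight_def)
qed

text \<open>A basis of \<open>A\<close> becomes dependent with \<open>e\<close>, so \<open>e\<close>
  lies inside a tight set of this basis, and such a set is tree-connected in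
  \<open>A\<close>.\<close>

lemma span_tc:
  assumes "A \<subseteq> E" "e \<in> span A" "e \<notin> A"
  obtains C where "tc A C" "en e \<subseteq> C"
proof -
  obtain B where B: "B \<subseteq> A" "sparse m en B" "card B = rank A"
    using rank_attained[OF assms(1)] .
  have e: "e \<in> E" "rank (insert e A) = rank A"
    using assms(2) by (auto simp: span_def)
  have "\<not> sparse m en (insert e B)"
  proof
    assume "sparse m en (insert e B)"
    then have "card (insert e B) \<le> rank (insert e A)"
      using B(1) assms(1) e(1) by (intro card_le_rank) auto
    moreover have "finite B"
      using B(1) assms(1) finite_subE by blast
    ultimately show False
      using B assms(3) e(2) by (auto simp: card_insert_if split: if_splits)
  qed
  then obtain C where "tight B C" "en e \<subseteq> C"
    using not_sparse_insert[of B e] B(1,2) assms(1) e(1) by blast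
  then show ?thesis
    using that tight_imp_tc[OF assms(1) B(1,2)] by blast
qed

text \<open>An edge missing from a basis \<open>B\<close> of \<open>E\<close> lies in a tight set
  and hence inside a component. So \<open>B\<close> contains all edges between components, and it
  remains to see that it induces a basis in each component.\<close>

lemma rank_parts:
  assumes "parts = union_closed.parts V (tc E)"
  shows "rank E = (\<Sum>p \<in> parts. m * (card p - 1)) + card {e \<in> E. \<forall>p \<in> parts. \<not> en e \<subseteq> p}"
proof -
  interpret comp: union_closed V "tc E"
    by (rule tc_union_closed) simp
  note assms [simp]
  obtain B where B: "B \<subseteq> E" "sparse m en B" "card B = rank E"
    using rank_attained[OF order_refl] .
  have outside: "\<exists>C. tight B C \<and> tc E C \<and> en e \<subseteq> C" if e: "e \<in> E - B" for e
  proof -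
    have "\<not> sparse m en (insert e B)"
      using B e card_le_rank[of E "insert e B"] finite_subE[OF B(1)] by auto
    then show ?thesis
      using not_sparse_insert[OF B(1,2), of e] e tight_imp_tc[OF order_refl B(1,2)] by blast
  qed
  have "card (within en B p) = m * (card p - 1)" if p: "p \<in> parts" for p
  proof -
    have tp: "tc E p"
      using comp.parts_Q p by simp
    have "card (within en B p) = rank (within en E p)"
    \<comment> \<open>The tight set that blocks an edge inside \<open>p\<close> is tree-connected
      and meets \<open>p\<close>, so it is contained in \<open>p\<close> by maximality and still
      blocks the edge when \<open>B\<close> is restricted to \<open>p\<close>.\<close>
    proof (rule card_eq_rank)
      show "sparse m en (within en B p)"
        using B by (intro sparse_subset[OF B(2) within_subset])
      show "\<not> sparse m en (insert e (within en B p))" if e: "e \<in> within en E p - within en B p" for e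
      proof -
        have eB: "e \<in> E - B" "en e \<subseteq> p"
          using e by (auto simp: within_def)
        obtain C where C: "tight B C" "tc E C" "en e \<subseteq> C"
          using outside eB by blast
        have "C \<inter> p \<noteq> {}"
          using C(3) eB ends_nonempty[of e] by blast
        then have "C \<subseteq> p"
          using comp.parts_maximal[of p C] p C(2) by simp
        then have "within en (insert e (within en B p)) C = insert e (within en B C)"
          using C(3) by (auto simp: within_def)
        moreover have "e \<notin> within en B C"
          using eB by (auto simp: within_def)
        ultimately have "card (within en (insert e (within en B p)) C) > m * (card C - 1)"
          using C(1) finite_within[OF B(1)] by (simp add: tight_def)
        then show ?thesis
          using sparse_cardD[of "insert e (within en B p)" C] C(1) by (auto simp: tight_def)
      qed
    qed (use B in \<open>auto simp: within_def\<close>)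
    then show ?thesis
      using tp by (simp add: tc_def)
  qed
  moreover have "{e \<in> E. \<forall>p \<in> parts. \<not> en e \<subseteq> p} = {e \<in> B. \<forall>p \<in> parts. \<not> en e \<subseteq> p}"
  proof -
    have "e \<in> B" if e: "e \<in> E" "\<forall>p \<in> parts. \<not> en e \<subseteq> p" for e
    proof (rule ccontr)
      assume "e \<notin> B"
      then obtain C where "tc E C" "en e \<subseteq> C"
        using outside e(1) by blast
      then show False
        using comp.Q_subset_part[of C] e(2) unfolding tc_def assms by blast
    qed
    then show ?thesis
      using B(1) by blast
  qed
  moreover have "card B = (\<Sum>p \<in> parts. card (within en B p)) + card {e \<in> B. \<forall>p \<in> parts. \<not> en e \<subseteq> p}"
    using comp.card_edges_parts[of B en] finite_subE[OF B(1)] ends_nonempty B(1) by auto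
  ultimately show ?thesis
    using B(3) by simp
qed

end

section \<open>The rank formula for Omega\<close>

lemma reach_cong: "(\<And>e. e \<in> A \<Longrightarrow> en e = en' e) \<Longrightarrow> reach en A = reach en' A"
  unfolding reach_def by (intro arg_cong[of _ _ rtrancl]) auto

lemma reach_ends: "reach (ends H) (edges H) = (adjacency H)\<^sup>*"
  by (simp add: reach_def adjacency_def)

text \<open>The other edges of a cycle join the ends of its last edge \<open>es ! n\<close>, so this
  edge is not a bridge. It runs from \<open>vs ! n\<close> back to \<open>vs ! 0\<close> because its
  index wraps around modulo the length.\<close>

lemma forest_no_cycle:
  assumes "forest (ends H) (edges H)"
  shows "\<not> is_cycle H vs es"
proof
  assume cyc: "is_cycle H vs es"
  define n where "n = length vs - 1"
  have n: "length vs = Suc n" "length es = Suc n" "n \<ge> 1"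
    using cyc by (auto simp: is_cycle_def n_def)
  have ends: "ends H (es ! i) = {vs ! i, vs ! (Suc i mod Suc n)}" if "i \<le> n" for i
    using cyc n that by (simp add: is_cycle_def)
  let ?A = "edges H - {es ! n}"
  have "k \<le> n \<Longrightarrow> (vs ! 0, vs ! k) \<in> reach (ends H) ?A" for k
  proof (induction k)
    case (Suc k)
    have "es ! k \<noteq> es ! n"
      using cyc n Suc.prems by (simp add: is_cycle_def nth_eq_iff_index_eq)
    moreover have "es ! k \<in> edges H"
      using cyc n Suc.prems nth_mem[of k es] by (auto simp: is_cycle_def)
    ultimately have "(vs ! k, vs ! Suc k) \<in> reach (ends H) ?A"
      using ends[of k] Suc.prems by (intro reach_edge[of "es ! k"]) auto
    then show ?case
      using Suc reach_trans by fastforce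
  qed simp
  then have "(vs ! n, vs ! 0) \<in> reach (ends H) ?A"
    by (simp add: reach_sym)
  moreover have "es ! n \<in> edges H"
    using cyc n nth_mem[of n es] by (auto simp: is_cycle_def)
  ultimately show False
    using assms ends[of n] unfolding forest_def by auto
qed

context graph_sparsity
begin

lemma spanning_tree_induced:
  assumes "C \<subseteq> V" "B \<subseteq> within en E C" "forest en B" "C \<times> C \<subseteq> reach en B"
  shows "spanning_tree \<lparr>vertices = C, edges = B, ends = en\<rparr> (induced G C)"
proof -
  let ?T = "\<lparr>vertices = C, edges = B, ends = en\<rparr>"
  have BE: "B \<subseteq> E"
    using assms(2) by (auto simp: within_def)
  have "multigraph ?T"
    using assms(2) finite_subV[OF assms(1)] finite_subE[OF BE] BE card_ends
    by unfold_locales (auto simp: within_def)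
  moreover have "multigraph (induced G C)"
    using finite_vertices finite_edges ends_subset card_ends
    by unfold_locales (auto simp: induced_def)
  ultimately have "factor ?T (induced G C)"
    using assms by (auto simp: factor_def subgraph_def induced_def within_def)
  moreover have "connected_graph ?T"
    using assms(4) by (auto simp: connected_graph_def simp flip: reach_ends)
  moreover have "\<nexists>vs es. is_cycle ?T vs es"
    using forest_no_cycle[of ?T] assms(3) by simp
  ultimately show ?thesis
    by (simp add: spanning_tree_def tree_graph_def)
qed

lemma tree_connected_induced_iff:
  assumes C: "C \<noteq> {}" "C \<subseteq> V"
  shows "tree_connected m (induced G C) \<longleftrightarrow> tc E C"
proof
  assume "tree_connected m (induced G C)"
  then obtain T where T: "\<And>i. i < m \<Longrightarrow> spanning_tree (T i) (induced G C)"
    and disj: "\<And>i j. i < m \<Longrightarrow> j < m \<Longrightarrow> i \<noteq> j \<Longrightarrow> edges (T i) \<inter> edges (T j) = {}"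
    unfolding tree_connected_def by blast
  have "edges (T i) \<subseteq> within en E C \<and> C \<times> C \<subseteq> reach en (edges (T i))" if "i < m" for i
  proof -
    have fac: "factor (T i) (induced G C)" and con: "connected_graph (T i)"
      using T[OF that] by (auto simp: spanning_tree_def tree_graph_def)
    have sub: "edges (T i) \<subseteq> within en E C" "vertices (T i) = C"
        "\<And>e. e \<in> edges (T i) \<Longrightarrow> ends (T i) e = en e"
      using fac C(2) by (auto simp: factor_def subgraph_def induced_def within_def)
    have "reach en (edges (T i)) = (adjacency (T i))\<^sup>*"
      using reach_cong[of "edges (T i)" "ends (T i)" en] sub(3) by (simp add: reach_ends)
    then show ?thesis
      using sub con by (auto simp: connected_graph_def)
  qed
  then have "packs E C"
    unfolding packs_def using C disj by (intro conjI exI[of _ "\<lambda>i. edges (T i)"]) auto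
  then show "tc E C"
    by (rule packs_imp_tc[OF order_refl])
next
  assume "tc E C"
  then have "packs E C"
    by (rule tc_imp_packs[OF order_refl])
  then obtain c where c: "\<And>i. i < m \<Longrightarrow> c i \<subseteq> within en E C" "\<And>i. i < m \<Longrightarrow> forest en (c i)"
    "\<And>i. i < m \<Longrightarrow> C \<times> C \<subseteq> reach en (c i)" "\<And>i j. i < m \<Longrightarrow> j < m \<Longrightarrow> i \<noteq> j \<Longrightarrow> c i \<inter> c j = {}"
    by (rule packs_forests[OF order_refl]) blast
  show "tree_connected m (induced G C)"
    unfolding tree_connected_def
  proof (intro exI conjI allI impI)
    show "spanning_tree \<lparr>vertices = C, edges = c i, ends = en\<rparr> (induced G C)" if "i < m" for i
      using spanning_tree_induced[OF C(2) c(1-3)] that by blast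
  qed (simp add: c(4))
qed

lemma tree_components_eq: "tree_components m G = union_closed.parts V (tc E)"
proof -
  interpret comp: union_closed V "tc E"
    by (rule tc_union_closed) simp
  have *: "C \<in> tree_components m G \<longleftrightarrow> tc E C \<and> (\<forall>D. C \<subseteq> D \<and> tc E D \<longrightarrow> D = C)" for C
    unfolding tree_components_def mem_Collect_eq
    using tree_connected_induced_iff by (metis subset_empty tc_def)
  show ?thesis
  proof (intro equalityI subsetI)
    fix C assume C: "C \<in> tree_components m G"
    then have "tc E C"
      using * by blast
    then obtain p where p: "p \<in> comp.parts" "C \<subseteq> p"
      using comp.Q_subset_part[of C] unfolding tc_def by blast
    then have "p = C"
      using C * comp.parts_Q by blast
    then show "C \<in> comp.parts"
      using p by simp
  next
    fix p assume p: "p \<in> comp.parts"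
    have "D = p" if "p \<subseteq> D" "tc E D" for D
      using comp.parts_maximal[OF p that(2)] comp.parts_nonempty[OF p] that(1) by blast
    then show "p \<in> tree_components m G"
      using * comp.parts_Q[OF p] by blast
  qed
qed

text \<open>The parts cover \<open>V\<close>, so the edges inside no part are exactly the crossing
  edges. With \<open>rank_parts\<close> and \<open>sum_parts\<close> every reference to the
  partition then cancels.\<close>

lemma Omega_rank: "Omega m G = int m * int (card V) - int (rank E)"
proof -
  interpret comp: union_closed V "tc E"
    by (rule tc_union_closed) simp
  have cross: "cross_edges G comp.parts = {e \<in> E. \<forall>p \<in> comp.parts. \<not> en e \<subseteq> p}"
  proof (intro equalityI subsetI)
    fix e assume "e \<in> cross_edges G comp.parts"
    then obtain A B where e: "e \<in> E" "A \<in> comp.parts" "B \<in> comp.parts" "A \<noteq> B"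
        "en e \<inter> A \<noteq> {}" "en e \<inter> B \<noteq> {}"
      by (auto simp: cross_edges_def)
    have "\<not> en e \<subseteq> p" if "p \<in> comp.parts" for p
      using comp.parts_disjoint[OF that] e by blast
    then show "e \<in> {e \<in> E. \<forall>p \<in> comp.parts. \<not> en e \<subseteq> p}"
      using e(1) by blast
  next
    fix e assume e: "e \<in> {e \<in> E. \<forall>p \<in> comp.parts. \<not> en e \<subseteq> p}"
    obtain u v where uv: "en e = {u, v}"
      using card_ends[of e] e by (auto simp: card_2_iff)
    then have "u \<in> \<Union>comp.parts" "v \<in> \<Union>comp.parts"
      using ends_subset[of e] e comp.Union_parts by auto
    then obtain A B where AB: "A \<in> comp.parts" "u \<in> A" "B \<in> comp.parts" "v \<in> B"
      by blast
    then have "A \<noteq> B" "en e \<inter> A \<noteq> {}" "en e \<inter> B \<noteq> {}"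
      using e uv by auto
    then show "e \<in> cross_edges G comp.parts"
      using e AB(1,3) unfolding cross_edges_def by (simp only: mem_Collect_eq) meson
  qed
  define cc where "cc = {e \<in> E. \<forall>p \<in> comp.parts. \<not> en e \<subseteq> p}"
  have 1: "rank E = (\<Sum>p \<in> comp.parts. m * (card p - 1)) + card cc"
    unfolding cc_def by (rule rank_parts[OF refl])
  note 2 = comp.sum_parts[of m]
  have "m * card comp.parts + rank E = m * card V + card cc"
    using 1 2 by simp
  then have "int m * int (card comp.parts) + int (rank E) = int m * int (card V) + int (card cc)"
    by (metis of_nat_add of_nat_mult)
  then show ?thesis
    unfolding Omega_def tree_components_eq cross cc_def[symmetric] by simp
qed

lemma tree_connected_iff_rank:
  assumes "V \<noteq> {}"
  shows "tree_connected m G \<longleftrightarrow> rank E = m * (card V - 1)"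
proof -
  have "within en E V = E"
    using ends_subset by (auto simp: within_def)
  moreover have "induced G V = G"
    using ends_subset by (auto simp: induced_def intro!: mgraph.equality)
  ultimately show ?thesis
    using tree_connected_induced_iff[OF assms order_refl] assms by (simp add: tc_def)
qed

end

section \<open>The exchange argument\<close>

definition edge_degree :: "('e \<Rightarrow> 'v set) \<Rightarrow> 'e set \<Rightarrow> 'v \<Rightarrow> int" where
  "edge_degree en A v = int (card {e \<in> A. v \<in> en e})"

lemma edge_degree_cong:
  "{e \<in> A. v \<in> en e} = {e \<in> B. v \<in> en e} \<Longrightarrow> edge_degree en A v = edge_degree en B v"
  by (simp add: edge_degree_def)

locale relative_bases = graph_sparsity G m for G :: "('v, 'e) mgraph" and m :: nat +
  fixes F :: "'e set"
  assumes F_subset: "F \<subseteq> E"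
begin

text \<open>The bases of the matroid obtained by contracting \<open>F\<close>.\<close>

definition base :: "'e set \<Rightarrow> bool" where
  "base T \<longleftrightarrow> T \<subseteq> E - F \<and> card T + rank F = rank E \<and> rank (F \<union> T) = rank E"

lemma base_subset: "base T \<Longrightarrow> T \<subseteq> E"
  by (auto simp: base_def)

lemma base_Un_subset: "base T \<Longrightarrow> F \<union> T \<subseteq> E"
  using base_subset F_subset by blast

lemma base_exists: "\<exists>T. base T"
proof -
  obtain I where I: "I \<subseteq> F" "sparse m en I" "card I = rank F"
    using rank_attained[OF F_subset] .
  obtain B where B: "I \<subseteq> B" "B \<subseteq> E" "sparse m en B" "card B = rank E"
    using extend_to_basis[OF _ order_refl I(2)] I(1) F_subset by (metis order_trans)
  have "sparse m en (B \<inter> F)"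
    using B by (intro sparse_subset[OF B(3)]) auto
  then have "card (B \<inter> F) \<le> rank F"
    using F_subset by (intro card_le_rank) auto
  moreover have "card I \<le> card (B \<inter> F)"
    using I(1) B(1) finite_subE[OF B(2)] by (intro card_mono) auto
  moreover have "card B = card (B \<inter> F) + card (B - F)"
    using finite_subE[OF B(2)] by (metis card_Int_Diff)
  ultimately have "card (B - F) + rank F = rank E"
    using I(3) B(4) by simp
  moreover have "rank B \<le> rank (F \<union> (B - F))" "rank (F \<union> (B - F)) \<le> rank E"
    using B(2) F_subset by (auto intro!: rank_mono)
  then have "rank (F \<union> (B - F)) = rank E"
    using rank_indep[OF B(2,3)] B(4) by simp
  ultimately show ?thesis
    using B(2) unfolding base_def by (intro exI[of _ "B - F"]) auto
qed

text \<open>\<open>T\<close> is independent over \<open>F\<close>, and so is its subset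
  \<open>Z\<close>; by diminishing returns \<open>Z\<close> is independent over every smaller
  \<open>A\<close> as well.\<close>

lemma base_rank_add:
  assumes "base T" "Z \<subseteq> T" "A \<subseteq> F"
  shows "rank (A \<union> Z) = rank A + card Z"
proof -
  have TE: "T \<subseteq> E" "finite T"
    using base_subset[OF assms(1)] finite_subE by auto
  have ZE: "Z \<subseteq> E"
    using TE assms(2) by blast
  have "F \<union> Z \<union> (T - Z) = F \<union> T"
    using assms(2) by blast
  then have "rank (F \<union> T) \<le> rank (F \<union> Z) + card (T - Z)"
    using rank_Un_le[of "F \<union> Z" "T - Z"] ZE TE F_subset by (metis Diff_subset le_sup_iff order_trans)
  moreover have "card (T - Z) + card Z = card T"
    using assms(2) TE by (metis card_Diff_subset card_mono finite_subset le_add_diff_inverse2)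
  ultimately have "rank F + card Z \<le> rank (F \<union> Z)"
    using assms(1) by (simp add: base_def)
  moreover have "rank (F \<union> Z) + rank A \<le> rank (A \<union> Z) + rank F"
    using rank_gain_antimono[OF assms(3) F_subset ZE] .
  moreover have "rank (A \<union> Z) \<le> rank A + card Z"
    using rank_Un_le[of A Z] ZE assms(3) F_subset by blast
  ultimately show ?thesis
    by linarith
qed

lemma within_Un: "within en (A \<union> B) C = within en A C \<union> within en B C"
  by (auto simp: within_def)

text \<open>Bases have equal size, so two that agree outside \<open>C\<close> have equally many
  edges inside. By \<open>base_rank_add\<close> the rank inside \<open>C\<close> depends on the base
  only through this number.\<close>

lemma base_tc_transfer:
  assumes "base T" "base T'" "tc (F \<union> T) C" "T - within en E C = T' - within en E C"
  shows "card (within en T' C) = card (within en T C)" and "tc (F \<union> T') C"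
proof -
  have split: "card U = card (within en U C) + card (U - within en E C)" if "base U" for U
  proof -
    have "U \<inter> within en E C = within en U C" "finite U"
      using base_subset[OF that] finite_subE by (auto simp: within_def)
    then show ?thesis
      by (metis card_Int_Diff)
  qed
  have "card T = card T'"
    using assms(1,2) by (simp add: base_def)
  then show eq: "card (within en T' C) = card (within en T C)"
    using split[OF assms(1)] split[OF assms(2)] assms(4) by simp
  have "rank (within en (F \<union> U) C) = rank (within en F C) + card (within en U C)" if "base U" for U
    unfolding within_Un by (rule base_rank_add[OF that within_subset within_subset])
  then show "tc (F \<union> T') C"
    using assms(1-3) eq by (simp add: tc_def)
qed

lemma rank_eq_if_spanning:
  assumes "A \<subseteq> E" "base T" "F \<union> T \<subseteq> span A"
  shows "rank A = rank E"
proof -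
  have "rank (F \<union> T) \<le> rank (A \<union> (F \<union> T))"
    using assms(1) base_Un_subset[OF assms(2)] by (intro rank_mono) auto
  also have "\<dots> = rank A"
    using rank_Un_span[OF assms(1,3)] .
  finally show ?thesis
    using rank_mono[OF assms(1) order_refl] assms(2) by (simp add: base_def)
qed

lemma base_swap:
  assumes T: "base T" and e: "e \<in> E" "e \<notin> F \<union> T" and f: "f \<in> T" "f \<in> span (F \<union> insert e (T - {f}))"
  shows "base (insert e (T - {f}))"
proof -
  let ?T = "insert e (T - {f})"
  have sub: "F \<union> ?T \<subseteq> E"
    using base_Un_subset[OF T] e by auto
  have "T \<subseteq> span (F \<union> ?T)"
    using f(2) span_superset[OF sub] by auto
  then have "rank (F \<union> ?T) = rank E"
    using span_superset[OF sub] by (intro rank_eq_if_spanning[OF sub T]) auto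
  moreover have "card ?T = card T"
    using e f(1) finite_subE[OF base_subset[OF T]]
    by (subst card_insert_disjoint) (auto simp: card_Suc_Diff1 simp del: card_Diff_insert)
  ultimately show ?thesis
    using T e by (auto simp: base_def)
qed

text \<open>Tree-connectedness of \<open>C\<close> makes the inserted part span all edges inside
  \<open>C\<close>, including those of \<open>U\<close> that were removed. This allows changes in
  disjoint components to be combined.\<close>

lemma base_splice:
  assumes U: "base U" and W: "base W" and C: "tc (F \<union> W) C"
    and eq: "card (within en U C) = card (within en W C)"
  shows "base ((U - within en E C) \<union> within en W C)" (is "base ?T")
proof -
  have sub: "F \<union> ?T \<subseteq> E"
    using base_Un_subset[OF U] base_Un_subset[OF W] by (auto simp: within_def)
  have "within en (F \<union> ?T) C = within en (F \<union> W) C"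
    using base_subset[OF U] by (auto simp: within_def)
  then have "tc (F \<union> ?T) C"
    using C by (simp add: tc_def)
  then have "within en E C \<subseteq> span (F \<union> ?T)"
    by (rule within_subset_span[OF sub])
  moreover have "F \<union> ?T \<subseteq> span (F \<union> ?T)"
    by (rule span_superset[OF sub])
  ultimately have "F \<union> U \<subseteq> span (F \<union> ?T)"
    by blast
  then have "rank (F \<union> ?T) = rank E"
    by (rule rank_eq_if_spanning[OF sub U])
  moreover have "card ?T = card U"
  proof -
    have fin: "finite U" "finite W"
      using base_subset[OF U] base_subset[OF W] finite_subE by auto
    have "card ?T = card (U - within en E C) + card (within en W C)"
      using fin base_subset[OF W] by (intro card_Un_disjoint) (auto simp: within_def)
    moreover have "U \<inter> within en E C = within en U C"
      using base_subset[OF U] by (auto simp: within_def)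
    ultimately show ?thesis
      using card_Int_Diff[OF fin(1), of "within en E C"] eq by simp
  qed
  ultimately show ?thesis
    using U W by (auto simp: base_def within_def)
qed

end

text \<open>\<open>no_improvement\<close> is all that the argument uses of a base minimizing the total excess
  \<open>\<Sum>v\<in>X. max 0 (edge_degree en T v - g v)\<close>.\<close>

locale optimal_base = relative_bases G m F for G :: "('v, 'e) mgraph" and m :: nat and F :: "'e set" +
  fixes X :: "'v set" and g :: "'v \<Rightarrow> int" and T :: "'e set"
  assumes X_subset: "X \<subseteq> V"
    and base_T: "base T"
    and no_improvement: "base T' \<Longrightarrow>
      (\<And>w. w \<in> X \<Longrightarrow> edge_degree en T' w \<le> max (g w) (edge_degree en T w)) \<Longrightarrow>
      v \<in> X \<Longrightarrow> g v < edge_degree en T v \<Longrightarrow> edge_degree en T v \<le> edge_degree en T' v"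
begin

abbreviation deg :: "'e set \<Rightarrow> 'v \<Rightarrow> int" where
  "deg \<equiv> edge_degree en"

section \<open>Admissible changes and critical vertices\<close>

definition K :: "'v set \<Rightarrow> 'e set" where
  "K S = F \<union> {e \<in> T. en e \<inter> S = {}}"

definition comp :: "'v set \<Rightarrow> 'v \<Rightarrow> 'v set" where
  "comp S u = union_closed.hull (tc (K S)) u"

text \<open>Changes of \<open>T\<close> that are confined to one region and create no new excess: a
  degree may rise only up to \<open>g\<close>.\<close>

definition admissible :: "'v set \<Rightarrow> 'v set \<Rightarrow> 'e set \<Rightarrow> bool" where
  "admissible S D T' \<longleftrightarrow> base T' \<and> (\<forall>e \<in> (T - T') \<union> (T' - T). en e \<subseteq> D - S) \<and>
    (\<forall>w \<in> X. deg T' w \<le> max (g w) (deg T w))"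

text \<open>At a vertex of \<open>X - S\<close> that is not critical, some admissible change in its
  own component brings the degree strictly below \<open>g\<close>, which leaves room for one more
  edge there.\<close>

definition crit :: "'v set \<Rightarrow> 'v set" where
  "crit S = {v \<in> X - S. \<forall>T'. admissible S (comp S v) T' \<longrightarrow> g v \<le> deg T' v}"

lemma TE: "T \<subseteq> E" "finite T"
  using base_subset[OF base_T] finite_subE by auto

lemma K_subset: "K S \<subseteq> F \<union> T" "K S \<subseteq> E"
  using base_Un_subset[OF base_T] by (auto simp: K_def)

lemma K_antimono: "S \<subseteq> S' \<Longrightarrow> K S' \<subseteq> K S"
  by (auto simp: K_def)

lemma K_union_closed: "union_closed V (tc (K S))"
  by (rule tc_union_closed[OF K_subset(2)])

lemmas comp_tc = union_closed.hull_Q[OF K_union_closed, folded comp_def]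
  and in_comp = union_closed.in_hull[OF K_union_closed, folded comp_def]
  and subset_comp = union_closed.subset_hull[OF K_union_closed, folded comp_def]
  and comp_eq = union_closed.hull_eq[OF K_union_closed, folded comp_def]

lemma admissible_T: "admissible S D T"
  by (simp add: admissible_def base_T)

lemma crit_ge: "v \<in> crit S \<Longrightarrow> g v \<le> deg T v"
  using admissible_T by (auto simp: crit_def)

lemma excess_crit:
  assumes "v \<in> X" "v \<notin> S" "g v < deg T v"
  shows "v \<in> crit S"
proof -
  have "g v \<le> deg T' v" if "admissible S (comp S v) T'" for T'
    using no_improvement[of T' v] that assms by (force simp: admissible_def)
  then show ?thesis
    using assms by (simp add: crit_def)
qed

lemma not_crit_witness:
  assumes "x \<in> V" "x \<notin> S" "x \<notin> crit S"
  obtains T' where "admissible S (comp S x) T'" "x \<in> X \<Longrightarrow> deg T' x < g x"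
proof (cases "x \<in> X")
  case True
  then have "\<exists>T'. admissible S (comp S x) T' \<and> deg T' x < g x"
    using assms by (auto simp: crit_def not_le)
  then show ?thesis
    using that by blast
next
  case False
  then show ?thesis
    using that admissible_T by blast
qed

lemma deg_swap:
  assumes "finite A" "f \<in> A" "e \<notin> A"
  shows "deg (insert e (A - {f})) w = deg A w + (if w \<in> en e then 1 else 0) - (if w \<in> en f then 1 else 0)"
proof -
  define B where "B = {h \<in> A. w \<in> en h}"
  have B: "finite B" "e \<notin> B" "f \<in> B \<longleftrightarrow> w \<in> en f"
    using assms by (auto simp: B_def)
  have eq: "{h \<in> insert e (A - {f}). w \<in> en h} = (if w \<in> en e then insert e (B - {f}) else B - {f})"
    using assms by (auto simp: B_def)
  have "int (card (B - {f})) = int (card B) - (if w \<in> en f then 1 else 0)"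
  proof (cases "w \<in> en f")
    case True
    then have "card B = Suc (card (B - {f}))"
      using B by (intro card.remove) auto
    then show ?thesis
      using True by simp
  qed (use B in simp)
  moreover have "card (insert e (B - {f})) = Suc (card (B - {f}))"
    using B by (intro card_insert_disjoint) auto
  ultimately show ?thesis
    unfolding edge_degree_def eq by (simp flip: B_def)
qed

text \<open>The exchange argument. If the ends \<open>x\<close>, \<open>y\<close> of \<open>e\<close> lay in different components after
  deleting \<open>S' = S \<union> crit S\<close>, the degrees of \<open>x\<close> and \<open>y\<close> could be lowered independently inside
  these components; adding \<open>e\<close> then makes an edge at some \<open>v \<in> crit S\<close> redundant, and removing
  it contradicts that \<open>v\<close> is critical.\<close>

lemma span_step:
  assumes S': "S' = S \<union> crit S" and e: "e \<in> E" "en e \<inter> (S' \<union> crit S') = {}" "e \<in> span (K S)"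
  shows "e \<in> span (K S')"
proof (rule ccontr)
  assume no: "e \<notin> span (K S')"
  obtain x y where xy: "en e = {x, y}" "x \<noteq> y"
    using card_ends[OF e(1)] by (auto simp: card_2_iff)
  have V: "x \<in> V" "y \<in> V"
    using ends_subset[OF e(1)] xy by auto
  have KK: "K S' \<subseteq> K S"
    using S' by (intro K_antimono) auto
  have notK: "e \<notin> K S'"
    using no span_superset[OF K_subset(2), of S'] by blast
  have e_disj: "en e \<inter> S' = {}" "en e \<inter> S = {}"
    using e(2) S' by auto
  have notFT: "e \<notin> F \<union> T"
    using notK e_disj by (auto simp: K_def)
  \<comment> \<open>\<open>C\<close> and \<open>C'\<close> are the components of the ends of
    \<open>e\<close> after deleting \<open>S'\<close>; both turn out to lie in the single component
    \<open>D\<close> left by deleting only \<open>S\<close>.\<close>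
  define C where "C = comp S' x"
  define C' where "C' = comp S' y"
  define D where "D = comp S x"
  have tcC: "tc (K S') C" and tcC': "tc (K S') C'" and tcD: "tc (K S) D"
    using comp_tc V by (auto simp: C_def C'_def D_def)
  have inC: "x \<in> C" "y \<in> C'"
    using in_comp V by (auto simp: C_def C'_def)
  have span_C: "within en E C \<subseteq> span (K S')" and span_C': "within en E C' \<subseteq> span (K S')"
    using within_subset_span[OF K_subset(2)] tcC tcC' by auto
  have "y \<notin> C"
    using span_C no e(1) xy inC by (auto simp: within_def)
  have CC: "C \<inter> C' = {}"
  proof (rule ccontr)
    assume "C \<inter> C' \<noteq> {}"
    then have "C = C'"
      using comp_eq[of x _ S'] comp_eq[of y _ S'] V unfolding C_def C'_def by blast
    then show False
      using inC \<open>y \<notin> C\<close> by simp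
  qed
  have xyD: "x \<in> D" "y \<in> D"
  proof -
    show "x \<in> D"
      using in_comp V by (simp add: D_def)
    have "e \<notin> K S"
      using notFT K_subset(1) by blast
    then obtain Z where "tc (K S) Z" "en e \<subseteq> Z"
      using span_tc[OF K_subset(2) e(3)] by blast
    then show "y \<in> D"
      using subset_comp[of S Z x] xy by (auto simp: D_def)
  qed
  have CD: "C \<subseteq> D" "C' \<subseteq> D"
  proof -
    have "tc (K S) C" "tc (K S) C'"
      using tc_mono[OF KK K_subset(2)] tcC tcC' by auto
    moreover have "D = comp S y"
      using comp_eq[of x y S] xyD V by (simp add: D_def)
    ultimately show "C \<subseteq> D" "C' \<subseteq> D"
      using subset_comp[of S C x] subset_comp[of S C' y] inC by (auto simp: D_def)
  qed
  obtain Tx where Tx: "admissible S' C Tx" "x \<in> X \<Longrightarrow> deg Tx x < g x"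
    using not_crit_witness[of x S'] V e(2) xy unfolding C_def by blast
  obtain Ty where Ty: "admissible S' C' Ty" "y \<in> X \<Longrightarrow> deg Ty y < g y"
    using not_crit_witness[of y S'] V e(2) xy unfolding C'_def by blast
  have bx: "base Tx" and "base Ty"
    using Tx Ty by (auto simp: admissible_def)
  note by' = \<open>base Ty\<close>
  have sub: "Tx \<subseteq> E" "Ty \<subseteq> E"
    using base_subset bx by' by auto
  have dx: "h \<in> T \<longleftrightarrow> h \<in> Tx" if "\<not> en h \<subseteq> C - S'" for h
    using Tx(1) that unfolding admissible_def by blast
  have dy: "h \<in> T \<longleftrightarrow> h \<in> Ty" if "\<not> en h \<subseteq> C' - S'" for h
    using Ty(1) that unfolding admissible_def by blast
  \<comment> \<open>Both changes at once: \<open>Ty\<close> inside \<open>C'\<close> and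
    \<open>Tx\<close> elsewhere.\<close>
  define T' where "T' = (Tx - within en E C') \<union> within en Ty C'"
  have memT': "h \<in> T' \<longleftrightarrow> h \<in> (if en h \<subseteq> C' then Ty else Tx)" for h
    using sub by (auto simp: T'_def within_def)
  have d': "h \<in> T \<longleftrightarrow> h \<in> T'" if "\<not> en h \<subseteq> C - S'" "\<not> en h \<subseteq> C' - S'" for h
    using memT'[of h] dx[of h] dy[of h] that by auto
  have tcT: "tc (F \<union> T) C'" "tc (F \<union> T) D"
    using tc_mono[OF K_subset(1) base_Un_subset[OF base_T]] tcC' tcD by blast+
  have "T - within en E C' = Ty - within en E C'"
    using dy base_subset[OF base_T] sub by (auto simp: within_def)
  then have Ty_C': "tc (F \<union> Ty) C'" "card (within en Ty C') = card (within en T C')"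
    using base_tc_transfer[OF base_T by' tcT(1)] by auto
  \<comment> \<open>The change to \<open>Tx\<close> stays inside \<open>C\<close>, which is disjoint
    from \<open>C'\<close>; so \<open>Tx\<close> and \<open>Ty\<close> have equally many edges
    inside \<open>C'\<close>, as splicing requires.\<close>
  have "h \<in> T \<longleftrightarrow> h \<in> Tx" if "h \<in> E" "en h \<subseteq> C'" for h
    using dx[of h] that CC ends_nonempty[of h] by blast
  then have "within en Tx C' = within en T C'"
    using TE(1) sub(1) by (auto simp: within_def)
  then have base_T': "base T'"
    unfolding T'_def using Ty_C' by (intro base_splice bx by') auto
  have T'E: "T' \<subseteq> E"
    using base_subset[OF base_T'] .
  have "T - within en E D = T' - within en E D"
  proof (intro set_eqI)
    fix h
    show "h \<in> T - within en E D \<longleftrightarrow> h \<in> T' - within en E D"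
    proof (cases "en h \<subseteq> D")
      case True
      then show ?thesis
        using TE(1) T'E by (auto simp: within_def)
    next
      case False
      then have "h \<in> T \<longleftrightarrow> h \<in> T'"
        using d'[of h] CD by blast
      then show ?thesis
        by simp
    qed
  qed
  then have tcT': "tc (F \<union> T') D"
    using base_tc_transfer(2)[OF base_T base_T' tcT(2)] by blast
  \<comment> \<open>The analogue of \<open>K S'\<close> for \<open>T'\<close>. Every changed edge
    lies inside \<open>C\<close> or \<open>C'\<close>, which \<open>K S'\<close> already spans, so
    \<open>e\<close> is still not spanned.\<close>
  define A where "A = F \<union> {h \<in> T'. en h \<inter> S' = {}}"
  have AE: "A \<subseteq> E"
    using T'E F_subset by (auto simp: A_def)
  have "A \<subseteq> span (K S')"
  proof
    fix h assume h: "h \<in> A"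
    then have hE: "h \<in> E"
      using AE by blast
    show "h \<in> span (K S')"
    proof (cases "h \<in> K S'")
      case True
      then show ?thesis
        using span_superset[OF K_subset(2)] by blast
    next
      case False
      then have "h \<in> T'" "h \<notin> T"
        using h by (auto simp: A_def K_def)
      then have "en h \<subseteq> C \<or> en h \<subseteq> C'"
        using d'[of h] by blast
      then show ?thesis
        using span_C span_C' hE by (auto simp: within_def)
    qed
  qed
  then have notA: "e \<notin> span A"
    using span_minimal[OF _ K_subset(2)] no by blast
  \<comment> \<open>\<open>D\<close> stays tree-connected under the change, so the edges of
    \<open>T'\<close> inside \<open>D\<close> together with \<open>A\<close> do span
    \<open>e\<close>. The exchange then provides an edge \<open>f\<close> inside \<open>D\<close>
    that meets \<open>S'\<close>.\<close>
  have "within en (F \<union> T') D \<subseteq> A \<union> within en T' D"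
    by (auto simp: A_def within_def)
  moreover have "within en E D \<subseteq> span (within en (F \<union> T') D)"
  proof (rule within_subset_span)
    show "within en (F \<union> T') D \<subseteq> E"
      by (rule within_sub[OF base_Un_subset[OF base_T']])
    have "within en (within en (F \<union> T') D) D = within en (F \<union> T') D"
      by (auto simp: within_def)
    then show "tc (within en (F \<union> T') D) D"
      using tcT' by (simp add: tc_def)
  qed
  moreover have "e \<in> within en E D"
    using xyD xy e(1) by (auto simp: within_def)
  ultimately have "e \<in> span (A \<union> within en T' D)"
    using span_mono[of "within en (F \<union> T') D" "A \<union> within en T' D"] AE within_sub[OF T'E, of D] by blast
  then obtain f where f: "f \<in> within en T' D - A" "f \<in> span (insert e (A \<union> (within en T' D - {f})))"
    using span_exchange_set[OF AE within_sub[OF T'E]] notA by blast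
  have fT': "f \<in> T'" "en f \<subseteq> D" "f \<in> E" "en f \<inter> S' \<noteq> {}"
    using f(1) T'E by (auto simp: A_def within_def)
  have eT': "e \<notin> F \<union> T'"
    using notA span_superset[OF AE] e_disj by (auto simp: A_def)
  define T'' where "T'' = insert e (T' - {f})"
  have "insert e (A \<union> (within en T' D - {f})) \<subseteq> F \<union> T''"
    using f(1) by (auto simp: T''_def A_def within_def)
  moreover have "F \<union> T'' \<subseteq> E"
    using T'E F_subset e(1) by (auto simp: T''_def)
  ultimately have "f \<in> span (F \<union> T'')"
    using span_mono f(2) by blast
  then have base_T'': "base T''"
    unfolding T''_def using base_swap[OF base_T' e(1) eT' fT'(1)] by simp
  have fT: "f \<in> T"
    using d'[of f] fT' by blast
  \<comment> \<open>Otherwise \<open>K S\<close> would omit \<open>f\<close> and yet span it,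
    because \<open>f\<close> lies inside \<open>D\<close>; this contradicts the independence of
    \<open>T\<close> over \<open>F\<close>. So \<open>f\<close> reaches \<open>S'\<close> only
    through critical vertices of \<open>S\<close>.\<close>
  have f_S: "en f \<inter> S = {}"
  proof (rule ccontr)
    assume "en f \<inter> S \<noteq> {}"
    then have "K S \<subseteq> F \<union> (T - {f})"
      by (auto simp: K_def)
    moreover have "F \<union> (T - {f}) \<subseteq> E"
      using base_Un_subset[OF base_T] by blast
    moreover have "f \<in> span (K S)"
      using within_subset_span[OF K_subset(2) tcD] fT'(2,3) by (auto simp: within_def)
    ultimately have "f \<in> span (F \<union> (T - {f}))"
      using span_mono by blast
    then have "rank (insert f (F \<union> (T - {f}))) = rank (F \<union> (T - {f}))"
      by (simp add: span_def)
    moreover have "insert f (F \<union> (T - {f})) = F \<union> T"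
      using fT by blast
    moreover have "rank (F \<union> (T - {f})) = rank F + card (T - {f})" "rank (F \<union> T) = rank F + card T"
      using base_rank_add[OF base_T _ order_refl] by auto
    moreover have "card (T - {f}) < card T"
      using fT TE(2) by (rule card_Diff1_less[rotated])
    ultimately show False
      by simp
  qed
  obtain v where v: "v \<in> en f" "v \<in> crit S"
    using fT'(4) f_S S' by blast
  have vX: "v \<in> X" "v \<in> S'"
    using v(2) S' by (auto simp: crit_def)
  have degx: "deg T' w = deg Tx w" if "w \<notin> C'" for w
  proof (rule edge_degree_cong)
    show "{h \<in> T'. w \<in> en h} = {h \<in> Tx. w \<in> en h}"
      using memT' that by auto
  qed
  have degy: "deg T' w = deg Ty w" if "w \<notin> C" for w
  proof (rule edge_degree_cong)
    have "h \<in> T' \<longleftrightarrow> h \<in> Ty" if "w \<in> en h" for h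
    proof (cases "en h \<subseteq> C'")
      case False
      moreover have "\<not> en h \<subseteq> C"
        using that \<open>w \<notin> C\<close> by blast
      ultimately show ?thesis
        using memT'[of h] dx[of h] dy[of h] by auto
    qed (simp add: memT')
    then show "{h \<in> T'. w \<in> en h} = {h \<in> Ty. w \<in> en h}"
      by blast
  qed
  have deg': "deg T' w \<le> max (g w) (deg T w)" if "w \<in> X" for w
    using Tx(1) Ty(1) degx[of w] degy[of w] that CC unfolding admissible_def by (metis disjoint_iff)
  have deg'_x: "deg T' x < g x" if "x \<in> X"
    using Tx(2) that degx[of x] inC CC by force
  have deg'_y: "deg T' y < g y" if "y \<in> X"
    using Ty(2) that degy[of y] \<open>y \<notin> C\<close> by auto
  have fin: "finite T'"
    using T'E finite_subE by blast
  have deg'': "deg T'' w = deg T' w + (if w \<in> en e then 1 else 0) - (if w \<in> en f then 1 else 0)" for w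
    unfolding T''_def using eT' by (intro deg_swap fin fT'(1)) auto
  \<comment> \<open>Only \<open>e\<close> can raise degrees, and the preceding changes made room for
    it at those of its ends that lie in \<open>X\<close>.\<close>
  have le'': "deg T'' w \<le> max (g w) (deg T w)" if "w \<in> X" for w
  proof (cases "w \<in> en e")
    case True
    then have "deg T' w < g w"
      using xy deg'_x deg'_y that by auto
    then show ?thesis
      unfolding deg'' by auto
  next
    case False
    then show ?thesis
      using deg'[OF that] unfolding deg'' by auto
  qed
  have degv: "deg T'' v < deg T v"
  proof -
    have "deg T' v = deg T v"
      using d' vX(2) by (intro edge_degree_cong) blast
    moreover have "v \<notin> en e"
      using e_disj vX(2) by blast
    ultimately show ?thesis
      unfolding deg'' using v(1) by simp
  qed
  have "admissible S D T''"
    unfolding admissible_def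
  proof (intro conjI ballI base_T'' le'')
    fix h assume h: "h \<in> (T - T'') \<union> (T'' - T)"
    then consider "h = e" | "h = f" | "h \<in> (T - T') \<union> (T' - T)"
      by (auto simp: T''_def)
    then show "en h \<subseteq> D - S"
    proof cases
      case 1
      then show ?thesis
        using e_disj(2) xy xyD by auto
    next
      case 2
      then show ?thesis
        using fT'(2) f_S by blast
    next
      case 3
      then have "en h \<subseteq> C - S' \<or> en h \<subseteq> C' - S'"
        using d'[of h] by blast
      then show ?thesis
        using CD S' by blast
    qed
  qed
  moreover have "comp S v = D"
    using comp_eq[of x v S] V(1) v(1) fT'(2) by (auto simp: D_def)
  ultimately have "g v \<le> deg T'' v"
    using v(2) by (auto simp: crit_def)
  \<comment> \<open>As \<open>v\<close> is critical, its lowered degree is still at least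
    \<open>g v\<close>. Hence \<open>v\<close> has excess in \<open>T\<close>, and
    \<open>T''\<close> would be an improvement there.\<close>
  then have "g v < deg T v"
    using degv by linarith
  then show False
    using no_improvement[OF base_T'' le'' vX(1)] degv by linarith
qed

text \<open>Iterating \<open>S \<union> crit S\<close> from the empty set, \<open>span_step\<close>
  preserves a claim that lags by one layer: \<open>K (Sn n)\<close> spans the edges avoiding
  \<open>Sn (Suc n)\<close>. The layers grow strictly inside the finite \<open>X\<close> until none
  is added, and there the lag disappears; by \<open>excess_crit\<close> all vertices with excess
  have then been absorbed.\<close>

lemma stable_set_exists:
  obtains S where "S \<subseteq> X" "\<And>v. v \<in> S \<Longrightarrow> g v \<le> deg T v" "\<And>v. v \<in> X \<Longrightarrow> g v < deg T v \<Longrightarrow> v \<in> S"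
    "\<And>e. e \<in> E \<Longrightarrow> en e \<inter> S = {} \<Longrightarrow> e \<in> span (K S)"
proof -
  define Sn where "Sn n = ((\<lambda>S. S \<union> crit S) ^^ n) {}" for n
  have Sn: "Sn 0 = {}" "Sn (Suc n) = Sn n \<union> crit (Sn n)" for n
    by (simp_all add: Sn_def)
  have sub: "Sn n \<subseteq> X" for n
    by (induction n) (auto simp: Sn crit_def)
  have ge: "v \<in> Sn n \<Longrightarrow> g v \<le> deg T v" for n v
    by (induction n) (auto simp: Sn crit_ge)
  have span: "e \<in> E \<Longrightarrow> en e \<inter> Sn (Suc n) = {} \<Longrightarrow> e \<in> span (K (Sn n))" for n e
  proof (induction n arbitrary: e)
    case 0
    have "K {} = F \<union> T"
      by (auto simp: K_def)
    then have "span (K {}) = E"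
      using span_rank_eq[of "F \<union> T" E] base_Un_subset[OF base_T] base_T span_subset
      by (auto simp: base_def)
    then show ?case
      using 0 by (simp add: Sn(1))
  next
    case (Suc n)
    show ?case
    proof (rule span_step[OF Sn(2) Suc.prems(1)])
      show "en e \<inter> (Sn (Suc n) \<union> crit (Sn (Suc n))) = {}"
        using Suc.prems(2) by (simp add: Sn(2)[of "Suc n"])
      then show "e \<in> span (K (Sn n))"
        using Suc.IH[of e] Suc.prems(1) by blast
    qed
  qed
  have "\<exists>n. crit (Sn n) = {}"
  proof (rule ccontr)
    assume none: "\<nexists>n. crit (Sn n) = {}"
    have fin: "finite (Sn n)" for n
      using sub[of n] X_subset finite_subV by blast
    have "n \<le> card (Sn n)" for n
    proof (induction n)
      case (Suc n)
      have "Sn n \<subset> Sn (Suc n)"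
        using none by (auto simp: Sn crit_def)
      then have "card (Sn n) < card (Sn (Suc n))"
        by (rule psubset_card_mono[OF fin])
      then show ?case
        using Suc.IH by simp
    qed simp
    then have "Suc (card X) \<le> card (Sn (Suc (card X)))" .
    moreover have "card (Sn (Suc (card X))) \<le> card X"
      using sub X_subset finite_subV by (intro card_mono) auto
    ultimately show False
      by simp
  qed
  then obtain n where n: "crit (Sn n) = {}"
    by blast
  show ?thesis
  proof (rule that)
    show "v \<in> Sn n" if "v \<in> X" "g v < deg T v" for v
      using excess_crit[of v "Sn n"] n that by auto
    show "e \<in> span (K (Sn n))" if "e \<in> E" "en e \<inter> Sn n = {}" for e
      using span[of e n] that n by (simp add: Sn(2))
  qed (use sub ge in auto)
qed

end

section \<open>Counting\<close>

lemma degree_sum: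
  assumes "finite A" "finite S" "\<And>e. e \<in> A \<Longrightarrow> card (en e) = 2"
  shows "(\<Sum>v \<in> S. edge_degree en A v) = int (card {e \<in> A. en e \<inter> S \<noteq> {}}) + int (card (within en A S))"
proof -
  have "edge_degree en A v = (\<Sum>e \<in> A. if v \<in> en e then 1 else 0)" for v
    using assms(1) by (simp add: edge_degree_def sum.If_cases Int_def)
  then have "(\<Sum>v \<in> S. edge_degree en A v) = (\<Sum>e \<in> A. \<Sum>v \<in> S. if v \<in> en e then 1 else 0)"
    by (simp add: sum.swap[of _ A S])
  also have "\<dots> = (\<Sum>e \<in> A. int (card (en e \<inter> S)))"
    using assms(2) by (simp add: sum.If_cases Int_def conj_commute)
  also have "\<dots> = (\<Sum>e \<in> A. (if en e \<inter> S \<noteq> {} then 1 else 0) + (if en e \<subseteq> S then 1 else 0))"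
  proof (rule sum.cong[OF refl])
    fix e assume "e \<in> A"
    then obtain u v where "en e = {u, v}" "u \<noteq> v"
      using assms(3) by (meson card_2_iff)
    then show "int (card (en e \<inter> S)) = (if en e \<inter> S \<noteq> {} then 1 else 0) + (if en e \<subseteq> S then 1 else 0)"
      by (cases "u \<in> S"; cases "v \<in> S") auto
  qed
  also have "\<dots> = int (card {e \<in> A. en e \<inter> S \<noteq> {}}) + int (card (within en A S))"
    using assms(1) by (simp add: sum.distrib sum.If_cases Int_def within_def)
  finally show ?thesis .
qed

context graph_sparsity
begin

definition avoiding :: "'v set \<Rightarrow> 'e set" where
  "avoiding S = {e \<in> E. en e \<inter> S = {}}"

lemma Omega_delete:
  assumes "S \<subseteq> V"
  shows "Omega m (delete_vertices G S) = int m * (int (card V) - int (card S)) - int (rank (avoiding S))"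
proof -
  interpret D: graph_sparsity "delete_vertices G S" m
    using finite_vertices finite_edges ends_subset card_ends
    by unfold_locales (auto simp: delete_vertices_def)
  have "int (card (V - S)) = int (card V) - int (card S)"
    using card_Diff_subset[OF finite_subV[OF assms] assms] card_mono[OF finite_vertices assms] by simp
  then show ?thesis
    using D.Omega_rank by (simp add: delete_vertices_def avoiding_def)
qed

lemma Omega_induced:
  assumes "S \<subseteq> V"
  shows "Omega m (induced G S) = int m * int (card S) - int (rank (within en E S))"
proof -
  interpret I: graph_sparsity "induced G S" m
    using finite_vertices finite_edges ends_subset card_ends
    by unfold_locales (auto simp: induced_def)
  show ?thesis
    using I.Omega_rank assms by (simp add: induced_def within_def Int_absorb1)
qed

text \<open>Adding \<open>v\<close> to a nonempty vertex set raises its bound by \<open>m\<close>,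
  so \<open>m\<close> edges at \<open>v\<close> can join any independent set that avoids
  \<open>v\<close>.\<close>

lemma rank_star:
  assumes A: "A \<subseteq> E" "\<And>e. e \<in> A \<Longrightarrow> v \<notin> en e" and D: "D \<subseteq> E" "\<And>e. e \<in> D \<Longrightarrow> v \<in> en e"
  shows "rank A + min m (card D) \<le> rank (A \<union> D)"
proof -
  obtain I where I: "I \<subseteq> A" "sparse m en I" "card I = rank A"
    using rank_attained[OF A(1)] .
  obtain D' where D': "D' \<subseteq> D" "card D' = min m (card D)" "finite D'"
    using obtain_subset_with_card_n[of "min m (card D)" D] by auto
  have IE: "I \<subseteq> E" and finI: "finite I"
    using I(1) A(1) finite_subE by auto
  have "sparse m en (I \<union> D')"
    unfolding sparse_def
  proof (intro allI impI)
    fix C :: "'v set" assume C: "finite C \<and> C \<noteq> {}"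
    show "card (within en (I \<union> D') C) \<le> m * (card C - 1)"
    proof (cases "v \<in> C")
      case False
      then have "within en (I \<union> D') C = within en I C"
        using D(2) D'(1) by (auto simp: within_def)
      then show ?thesis
        using I(2) C by (simp add: sparse_def)
    next
      case v: True
      show ?thesis
      \<comment> \<open>For a singleton the set without \<open>v\<close> is empty and
        \<open>card (C - {v}) - 1\<close> would truncate; looplessness settles this case.\<close>
      proof (cases "C = {v}")
        case True
        have "\<not> en e \<subseteq> {v}" if "e \<in> I \<union> D'" for e
          using card_ends[of e] IE D' D(1) that card_mono[of "{v}" "en e"] by auto
        then have "within en (I \<union> D') C = {}"
          using True by (auto simp: within_def)
        then show ?thesis
          by simp
      next
        case False
        then have ne: "C - {v} \<noteq> {}"
          using v by blast
        have "within en (I \<union> D') C \<subseteq> within en I (C - {v}) \<union> D'"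
          using A(2) I(1) by (auto simp: within_def)
        then have "card (within en (I \<union> D') C) \<le> card (within en I (C - {v}) \<union> D')"
          using finite_within[OF IE] D'(3) by (intro card_mono) auto
        also have "\<dots> \<le> card (within en I (C - {v})) + card D'"
          by (rule card_Un_le)
        also have "\<dots> \<le> m * (card (C - {v}) - 1) + m"
          using I(2) C ne D'(2) by (intro add_mono) (auto simp: sparse_def)
        also have "\<dots> = m * card (C - {v})"
          using ne C by (cases "card (C - {v})") auto
        also have "\<dots> = m * (card C - 1)"
          using v C by (simp add: card_Diff_singleton)
        finally show ?thesis .
      qed
    qed
  qed
  moreover have "I \<union> D' \<subseteq> A \<union> D"
    using I(1) D'(1) by blast
  ultimately have "card (I \<union> D') \<le> rank (A \<union> D)"
    using A(1) D(1) by (intro card_le_rank) auto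
  moreover have "card (I \<union> D') = card I + card D'"
    using finI D'(1,3) I(1) A(2) D(2) by (intro card_Un_disjoint) auto
  ultimately show ?thesis
    using I(3) D'(2) by simp
qed

text \<open>Each edge of \<open>F\<close> at \<open>v \<in> S\<close> is counted by the first rank if it leads to a vertex outside
  \<open>S\<close> or to a vertex of \<open>S\<close> that is treated later, and by the second rank otherwise.\<close>

lemma rank_degree_bound:
  assumes F: "F \<subseteq> E" and "S \<subseteq> V"
  shows "rank (avoiding S) + (\<Sum>v \<in> S. min m (card {e \<in> F. v \<in> en e})) \<le>
    rank (F \<union> avoiding S) + rank (within en F S)"
proof -
  have "finite S"
    using assms(2) by (rule finite_subV)
  then show ?thesis
    using assms(2)
  proof (induction S)
    case empty
    have "rank (avoiding {}) \<le> rank (F \<union> avoiding {})"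
      using F by (intro rank_mono) (auto simp: avoiding_def)
    then show ?case
      by simp
  next
    case (insert v S)
    let ?S = "insert v S"
    define D1 where "D1 = {e \<in> F. v \<in> en e \<and> en e \<inter> S = {}}"
    define D2 where "D2 = {e \<in> F. v \<in> en e \<and> en e \<inter> S \<noteq> {}}"
    have sub: "avoiding S \<subseteq> E" "avoiding ?S \<subseteq> E" "D1 \<subseteq> E" "D2 \<subseteq> E"
      using F by (auto simp: avoiding_def D1_def D2_def)
    have "rank (avoiding ?S) + min m (card D1) \<le> rank (avoiding ?S \<union> D1)"
      using sub by (intro rank_star[of _ v]) (auto simp: avoiding_def D1_def)
    \<comment> \<open>The edges of \<open>D1\<close> avoid \<open>S\<close>, so adding
      \<open>F\<close> to all edges avoiding \<open>S\<close> gains at most as much as adding it to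
      the smaller set \<open>avoiding ?S \<union> D1\<close>.\<close>
    moreover have "rank (F \<union> avoiding S) + rank (avoiding ?S \<union> D1) \<le>
        rank (F \<union> avoiding ?S) + rank (avoiding S)"
    proof -
      have "F \<union> avoiding ?S = (avoiding ?S \<union> D1) \<union> F"
        by (auto simp: D1_def)
      then show ?thesis
        using F rank_gain_antimono[of "avoiding ?S \<union> D1" "avoiding S" F]
        by (auto simp: avoiding_def D1_def Un_commute)
    qed
    moreover have "rank (within en F S) + min m (card D2) \<le> rank (within en F S \<union> D2)"
      using sub within_sub[OF F] insert.hyps(2) by (intro rank_star[of _ v]) (auto simp: within_def D2_def)
    moreover have "rank (within en F S \<union> D2) \<le> rank (within en F ?S)"
    proof (intro rank_mono within_sub[OF F] Un_least within_mono)
      show "D2 \<subseteq> within en F ?S"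
      proof
        fix e assume e: "e \<in> D2"
        then obtain a b where "en e = {a, b}"
          using sub(4) card_ends[of e] by (auto simp: card_2_iff)
        then show "e \<in> within en F ?S"
          using e insert.hyps(2) by (auto simp: D2_def within_def)
      qed
    qed auto
    moreover have "min m (card {e \<in> F. v \<in> en e}) \<le> min m (card D1) + min m (card D2)"
    proof -
      have "{e \<in> F. v \<in> en e} = D1 \<union> D2"
        by (auto simp: D1_def D2_def)
      then have "card {e \<in> F. v \<in> en e} \<le> card D1 + card D2"
        by (simp add: card_Un_le)
      then show ?thesis
        by simp
    qed
    moreover have "(\<Sum>v \<in> ?S. min m (card {e \<in> F. v \<in> en e})) =
        min m (card {e \<in> F. v \<in> en e}) + (\<Sum>v \<in> S. min m (card {e \<in> F. v \<in> en e}))"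
      using insert.hyps by simp
    moreover have "rank (avoiding S) + (\<Sum>v \<in> S. min m (card {e \<in> F. v \<in> en e})) \<le>
        rank (F \<union> avoiding S) + rank (within en F S)"
      using insert.IH insert.prems by simp
    ultimately show ?case
      by linarith
  qed
qed

end

context relative_bases
begin

text \<open>\<open>nat\<close> cuts the excess off at zero, so raising a degree up to
  \<open>g\<close> costs nothing, whereas lowering a degree above \<open>g\<close> strictly
  decreases the total.\<close>

lemma optimal_base_exists:
  assumes "X \<subseteq> V"
  obtains T where "optimal_base G m F X g T"
proof -
  have "finite X"
    using assms by (rule finite_subV)
  define excess where "excess T = (\<Sum>v \<in> X. nat (edge_degree en T v - g v))" for T
  obtain T where T: "base T" "\<And>T'. base T' \<Longrightarrow> excess T \<le> excess T'"
    using base_exists ex_has_least_nat[of base _ excess] by blast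
  have "edge_degree en T v \<le> edge_degree en T' v"
    if T': "base T'" "\<And>w. w \<in> X \<Longrightarrow> edge_degree en T' w \<le> max (g w) (edge_degree en T w)"
      and v: "v \<in> X" "g v < edge_degree en T v" for T' v
  proof (rule ccontr)
    assume "\<not> edge_degree en T v \<le> edge_degree en T' v"
    then have "nat (edge_degree en T' v - g v) < nat (edge_degree en T v - g v)"
      using v(2) by linarith
    moreover have "nat (edge_degree en T' w - g w) \<le> nat (edge_degree en T w - g w)" if "w \<in> X" for w
      using T'(2)[OF that] by linarith
    ultimately have "excess T' < excess T"
      unfolding excess_def using \<open>finite X\<close> v(1) by (intro sum_strict_mono_ex1) auto
    then show False
      using T(2)[OF T'(1)] by simp
  qed
  then show ?thesis
    using that assms T(1) by (meson optimal_base.intro optimal_base_axioms.intro relative_bases_axioms)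
qed

end

context optimal_base
begin

lemma deg_le:
  assumes rank_E: "int (rank E) = int m * (int (card V) - 1)"
    and f: "\<And>v. v \<in> X \<Longrightarrow> g v = f v - int (min m (card {e \<in> F. v \<in> en e}))"
    and Omega: "\<And>S. S \<subseteq> X \<Longrightarrow> Omega m (delete_vertices G S)
      \<le> (\<Sum>v \<in> S. f v - 2 * int m) + int m + Omega m (induced G S)"
    and "v \<in> X"
  shows "deg T v \<le> g v"
proof (rule ccontr)
  assume "\<not> deg T v \<le> g v"
  obtain S where S: "S \<subseteq> X" "\<And>v. v \<in> S \<Longrightarrow> g v \<le> deg T v" "\<And>v. v \<in> X \<Longrightarrow> g v < deg T v \<Longrightarrow> v \<in> S"
    and span: "\<And>e. e \<in> E \<Longrightarrow> en e \<inter> S = {} \<Longrightarrow> e \<in> span (K S)"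
    using stable_set_exists by blast
  have SV: "S \<subseteq> V" "finite S"
    using S(1) X_subset finite_subV by blast+
  define Z where "Z = {e \<in> T. en e \<inter> S = {}}"
  have "(\<Sum>v \<in> S. g v) < (\<Sum>v \<in> S. deg T v)"
  proof (rule sum_strict_mono_ex1[OF SV(2)])
    show "\<exists>v \<in> S. g v < deg T v"
      using S(3)[OF \<open>v \<in> X\<close>] \<open>\<not> deg T v \<le> g v\<close> by (intro bexI[of _ v]) auto
  qed (simp add: S(2))
  moreover have "(\<Sum>v \<in> S. deg T v) = int (card {e \<in> T. en e \<inter> S \<noteq> {}}) + int (card (within en T S))"
    using TE card_ends SV(2) by (intro degree_sum) auto
  moreover have "card T = card {e \<in> T. en e \<inter> S \<noteq> {}} + card Z"
  proof -
    have "T = {e \<in> T. en e \<inter> S \<noteq> {}} \<union> Z"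
      by (auto simp: Z_def)
    moreover have "card ({e \<in> T. en e \<inter> S \<noteq> {}} \<union> Z) = card {e \<in> T. en e \<inter> S \<noteq> {}} + card Z"
      using TE(2) by (intro card_Un_disjoint) (auto simp: Z_def)
    ultimately show ?thesis
      by simp
  qed
  moreover have "card T + rank F = rank E"
    using base_T by (simp add: base_def)
  \<comment> \<open>\<open>K S\<close> spans all edges of G - S and consists of \<open>F\<close> and
    edges of this kind, so both sets have the same rank.\<close>
  moreover have "rank (F \<union> avoiding S) = rank F + card Z"
  proof -
    have "rank (K S \<union> avoiding S) = rank (K S)"
      using span by (intro rank_Un_span K_subset) (auto simp: avoiding_def)
    moreover have "K S \<union> avoiding S = F \<union> avoiding S"
      using TE(1) by (auto simp: K_def avoiding_def)
    moreover have "rank (K S) = rank F + card Z"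
      unfolding K_def Z_def by (intro base_rank_add[OF base_T]) auto
    ultimately show ?thesis
      by simp
  qed
  moreover have "rank (within en F S) + card (within en T S) \<le> rank (within en E S)"
  proof -
    have "rank (within en F S \<union> within en T S) = rank (within en F S) + card (within en T S)"
      by (rule base_rank_add[OF base_T within_subset within_subset])
    moreover have "rank (within en F S \<union> within en T S) \<le> rank (within en E S)"
      using F_subset TE(1) by (intro rank_mono within_sub) (auto simp: within_def)
    ultimately show ?thesis
      by simp
  qed
  moreover have "rank (avoiding S) + (\<Sum>v \<in> S. min m (card {e \<in> F. v \<in> en e})) \<le>
      rank (F \<union> avoiding S) + rank (within en F S)"
    by (rule rank_degree_bound[OF F_subset SV(1)])
  moreover have "(\<Sum>v \<in> S. g v) = (\<Sum>v \<in> S. f v) - int (\<Sum>v \<in> S. min m (card {e \<in> F. v \<in> en e}))"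
    using f S(1) by (simp add: sum_subtractf subset_iff)
  \<comment> \<open>The terms in |S| balance: -m|S| from the deleted graph on the left, and -2m|S| +
    m|S| from the sum and the induced graph on the right.\<close>
  moreover have "int m * (int (card V) - 1) \<le> (\<Sum>v \<in> S. f v) + int (rank (avoiding S)) - int (rank (within en E S))"
    using Omega[OF S(1)] unfolding Omega_delete[OF SV(1)] Omega_induced[OF SV(1)]
    by (simp add: sum_subtractf algebra_simps)
  ultimately show False
    using rank_E by linarith
qed

end

theorem theorem4p3:
  fixes m :: nat and G F :: "('v, 'e) mgraph" and X :: "'v set" and f :: "'v \<Rightarrow> int"
  assumes "m \<ge> 1"
    and "multigraph G"
    and "X \<subseteq> vertices G"
    and "factor F G"
    and "\<forall>v \<in> X. f v > 0"
    and "\<forall>S. S \<subseteq> X \<longrightarrow>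
           Omega m (delete_vertices G S)
             \<le> (\<Sum>v\<in>S. f v - 2 * int m) + int m + Omega m (induced G S)"
  shows "\<exists>H. factor H G \<and> tree_connected m H \<and> subgraph F H \<and>
           (\<forall>v \<in> X. int (vertex_degree H v)
              \<le> f v + max 0 (int (vertex_degree F v) - int m))"
proof (cases "vertices G = {}")
  \<comment> \<open>Without vertices the value m(|V| - 1) would be truncated; here \<open>F\<close>
    has no edges and is itself the required factor.\<close>
  case True
  have F: "multigraph F" "vertices F = {}"
    using assms(4) True by (auto simp: factor_def subgraph_def)
  have "edges F = {}"
    using multigraph.ends_subset[OF F(1)] multigraph.card_ends[OF F(1)] F(2) by fastforce
  moreover have "\<not> is_cycle F vs es" for vs es
    using F(2) by (auto simp: is_cycle_def)
  ultimately have "tree_connected m F"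
    unfolding tree_connected_def using F
    by (intro exI[of _ "\<lambda>_. F"])
      (auto simp: spanning_tree_def factor_def subgraph_def tree_graph_def connected_graph_def)
  then show ?thesis
    using assms(3,4) True F(1) by (intro exI[of _ F]) (auto simp: subgraph_def)
next
  case False
  interpret graph_sparsity G m
    using assms(2) by (simp add: graph_sparsity_def)
  have F: "edges F \<subseteq> E" "vertices F = V" "multigraph F" and endsF: "\<And>e. e \<in> edges F \<Longrightarrow> ends F e = en e"
    using assms(4) by (auto simp: factor_def subgraph_def)
  interpret relative_bases G m "edges F"
    using F(1) by unfold_locales
  define g where "g v = f v - int (min m (card {e \<in> edges F. v \<in> en e}))" for v
  obtain T where "optimal_base G m (edges F) X g T"
    using optimal_base_exists[OF assms(3)] by blast
  then interpret optimal_base G m "edges F" X g T .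
  have pos: "card V > 0"
    using False finite_vertices by (simp add: card_gt_0_iff)
  \<comment> \<open>The hypothesis for the empty set bounds Omega of \<open>G\<close> by
    \<open>m\<close>, so \<open>G\<close> itself is already m-tree-connected.\<close>
  have rank_E: "rank E = m * (card V - 1)"
  proof -
    have "avoiding {} = E" "within en E V = E" "within en E {} = {}"
      using ends_subset ends_nonempty by (auto simp: avoiding_def within_def)
    then have "int m * int (card V) \<le> int m + int (rank E)"
      using assms(6)[rule_format, of "{}"] Omega_delete[of "{}"] Omega_induced[of "{}"] rank_empty by simp
    then have "m * card V \<le> m + rank E"
      by (metis of_nat_add of_nat_le_iff of_nat_mult)
    then have "m * (card V - 1) \<le> rank E"
      using pos by (cases "card V") auto
    then show ?thesis
      using rank_within_le[of E V] \<open>within en E V = E\<close> False by simp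
  qed
  then have "int (rank E) = int m * (int (card V) - 1)"
    using pos by (simp add: of_nat_diff)
  then have deg: "edge_degree en T v \<le> g v" if "v \<in> X" for v
    using deg_le[of f v] assms(6) that by (simp add: g_def)
  define H where "H = \<lparr>vertices = V, edges = edges F \<union> T, ends = en\<rparr>"
  have sub: "edges F \<union> T \<subseteq> E"
    by (rule base_Un_subset[OF base_T])
  interpret H: graph_sparsity H m
    using finite_vertices finite_subE[OF sub] ends_subset card_ends sub
    by unfold_locales (auto simp: H_def)
  have "rank (edges F \<union> T) = m * (card V - 1)"
    using base_T rank_E by (simp add: base_def)
  then have "tree_connected m H"
    using H.tree_connected_iff_rank False by (simp add: H_def)
  moreover have "factor H G"
    using sub H.multigraph_axioms assms(2) by (auto simp: factor_def subgraph_def H_def)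
  moreover have "subgraph F H"
    using F endsF H.multigraph_axioms by (auto simp: subgraph_def H_def)
  moreover have "int (vertex_degree H v) \<le> f v + max 0 (int (vertex_degree F v) - int m)" if "v \<in> X" for v
  proof -
    have "{e \<in> edges F \<union> T. v \<in> en e} = {e \<in> edges F. v \<in> en e} \<union> {e \<in> T. v \<in> en e}"
      by blast
    then have "int (vertex_degree H v) \<le> int (card {e \<in> edges F. v \<in> en e}) + edge_degree en T v"
      using card_Un_le[of "{e \<in> edges F. v \<in> en e}" "{e \<in> T. v \<in> en e}"]
      by (simp add: vertex_degree_def H_def edge_degree_def)
    moreover have "{e \<in> edges F. v \<in> ends F e} = {e \<in> edges F. v \<in> en e}"
      using endsF by auto
    ultimately show ?thesis
      using deg[OF that] by (simp add: vertex_degree_def g_def)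
  qed
  ultimately show ?thesis
    by blast
qed

end
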